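(* Let $\beta^*>0$ be fixed, and suppose that the function $g:=g_1/g_2:\mathbb{R}_{>0}\to\mathbb{R}_{>0}$ is surjective and satisfies $g'(x)<0$ and $g''(x)\ge 0$ for all $x>0$. Let $\varepsilon>0$ be given. Then one can compute an $\varepsilon$-approximation of the positive solution of the system $$\left\{\begin{array}{rcl} 0&=&-(U_2-U_1)+\frac{h^2}{2}g_1(U_1),\\ 0&=&-(U_{k+1}-2U_k+U_{k-1})+h^2g_1(U_k)\quad(2\le k\le n-1),\\ 0&=&-(U_{n-1}-U_n)-hB^{-1}g_2(U_n)+\frac{h^2}{2}g_1(U_n)\end{array}\right.$$ for $B=\beta^*$, where $h:=1/(n-1)$, with $O\big(n\log_2\log_2(1/\varepsilon)\big)$ flops.
   Context: $n\ge 2$ is an integer. $g_1,g_2:\mathbb{R}\to\mathbb{R}$ are functions of class $\mathcal{C}^3(\mathbb{R})$, analytic at $x=0$, such that $g_i(0)=0$, $g_i'(x)>0$, $g_i''(x)>0$ and $g_i'''(x)\ge 0$ for all $x>0$ and $i=1,2$. When $g$ is surjective and strictly decreasing, the system has exactly one solution in $(\mathbb{R}_{>0})^n$ for each $B>0$; this is "the positive solution". An $\varepsilon$-approximation of a point $w\in\mathbb{R}^n$ is a point $v\in\mathbb{R}^n$ with $\|v-w\|_\infty<\varepsilon$. "Flops" are real arithmetic operations, where evaluations of $g_1,g_2,g_1',g_2'$ count as $O(1)$ flops. The constant implied by the $O$-notation (and any constants built into the algorithm) may depend on $g_1,g_2,\beta^*$ but not on $n$ or $\varepsilon$; the $O$-estimate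 is understood for $\varepsilon$ small enough that $\log_2\log_2(1/\varepsilon)$ is defined and bounded away from $0$. *)

theory Defs
  imports "HOL-Analysis.Analysis"
begin

section \<open>Regularity of real functions\<close>

definition class_C :: "nat \<Rightarrow> (real \<Rightarrow> real) \<Rightarrow> bool" where
  "class_C m f \<longleftrightarrow>
     (\<forall>j<m. \<forall>x. (deriv ^^ j) f differentiable (at x)) \<and> continuous_on UNIV ((deriv ^^ m) f)"

text \<open>The library's \<^const>\<open>analytic_on\<close> only covers complex functions.\<close>

definition real_analytic_at :: "(real \<Rightarrow> real) \<Rightarrow> real \<Rightarrow> bool" where
  "real_analytic_at f a \<longleftrightarrow>
     (\<exists>c r. r > 0 \<and> (\<forall>x. \<bar>x - a\<bar> < r \<longrightarrow> (\<lambda>k. c k * (x - a) ^ k) sums f x))"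


section \<open>The discretized boundary value problem\<close>

text \<open>Vectors of length \<open>n\<close> are functions on the indices \<open>1, \<dots>, n\<close>.\<close>

definition solves_system ::
    "(real \<Rightarrow> real) \<Rightarrow> (real \<Rightarrow> real) \<Rightarrow> real \<Rightarrow> nat \<Rightarrow> (nat \<Rightarrow> real) \<Rightarrow> bool" where
  "solves_system g1 g2 B n U \<longleftrightarrow>
     (let h = 1 / (real n - 1) in
        0 = - (U 2 - U 1) + h\<^sup>2 / 2 * g1 (U 1) \<and>
        (\<forall>k\<in>{2..n-1}. 0 = - (U (k+1) - 2 * U k + U (k-1)) + h\<^sup>2 * g1 (U k)) \<and>
        0 = - (U (n-1) - U n) - h * inverse B * g2 (U n) + h\<^sup>2 / 2 * g1 (U n))"

text \<open>Outside \<open>{1..n}\<close> the elements of the extensional function space are all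
  \<^const>\<open>undefined\<close>, so that a vector is determined by its \<open>n\<close> coordinates and the
  description below is not ambiguous for trivial reasons.\<close>

definition positive_solution ::
    "(real \<Rightarrow> real) \<Rightarrow> (real \<Rightarrow> real) \<Rightarrow> real \<Rightarrow> nat \<Rightarrow> nat \<Rightarrow> real" where
  "positive_solution g1 g2 B n =
     (THE U. U \<in> {1..n} \<rightarrow>\<^sub>E {0<..} \<and> solves_system g1 g2 B n U)"

definition linf_norm :: "nat \<Rightarrow> (nat \<Rightarrow> real) \<Rightarrow> real" where
  "linf_norm n x = Max ((\<lambda>k. \<bar>x k\<bar>) ` {1..n})"

definition eps_approximation :: "nat \<Rightarrow> real \<Rightarrow> (nat \<Rightarrow> real) \<Rightarrow> (nat \<Rightarrow> real) \<Rightarrow> bool" where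
  "eps_approximation n \<epsilon> w v \<longleftrightarrow> linf_norm n (\<lambda>k. v k - w k) < \<epsilon>"


section \<open>Algorithms over the reals and their cost in flops\<close>

text \<open>
  Algorithms are while programs of a real random access machine. A state consists of index
  registers, holding natural numbers, and of real memory cells, addressed by index expressions.
  Index values serve for loop control and addressing only: they are never converted into reals,
  nor reals into indices. A program is a finite text that may contain real constants; one and
  the same program has to handle all inputs.

  One flop is charged for each arithmetic operation on reals, each evaluation of \<open>g\<^sub>1\<close>, \<open>g\<^sub>2\<close> or
  one of their derivatives, and each comparison of reals. Index manipulation, copying and the
  loading of constants are free.
\<close>

datatype idx = INum nat | IReg nat | IAdd idx idx | ISub idx idx

datatype arith_op = Add | Sub | Mul | Div

datatype oracle_fun = G1 | G2 | DG1 | DG2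

datatype test = ILess idx idx | RLess idx idx

datatype prog =
    Skip
  | ISet nat idx
  | RConst idx real
  | RCopy idx idx
  | RArith idx arith_op idx idx
  | REval idx oracle_fun idx
  | Seq prog prog
  | Cond test prog prog
  | While test prog

type_synonym state = "(nat \<Rightarrow> nat) \<times> (nat \<Rightarrow> real)"

fun idx_val :: "(nat \<Rightarrow> nat) \<Rightarrow> idx \<Rightarrow> nat" where
  "idx_val r (INum k) = k"
| "idx_val r (IReg j) = r j"
| "idx_val r (IAdd a b) = idx_val r a + idx_val r b"
| "idx_val r (ISub a b) = idx_val r a - idx_val r b"

fun arith_val :: "arith_op \<Rightarrow> real \<Rightarrow> real \<Rightarrow> real" where
  "arith_val Add x y = x + y"
| "arith_val Sub x y = x - y"
| "arith_val Mul x y = x * y"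
| "arith_val Div x y = x / y"

fun oracle_val :: "(real \<Rightarrow> real) \<Rightarrow> (real \<Rightarrow> real) \<Rightarrow> oracle_fun \<Rightarrow> real \<Rightarrow> real" where
  "oracle_val g1 g2 G1 = g1"
| "oracle_val g1 g2 G2 = g2"
| "oracle_val g1 g2 DG1 = deriv g1"
| "oracle_val g1 g2 DG2 = deriv g2"

fun test_val :: "test \<Rightarrow> state \<Rightarrow> bool" where
  "test_val (ILess a b) (r, m) \<longleftrightarrow> idx_val r a < idx_val r b"
| "test_val (RLess a b) (r, m) \<longleftrightarrow> m (idx_val r a) < m (idx_val r b)"

fun test_cost :: "test \<Rightarrow> nat" where
  "test_cost (ILess a b) = 0"
| "test_cost (RLess a b) = 1"

text \<open>\<open>exec g1 g2 p s t s'\<close>: started in state \<open>s\<close>, the program \<open>p\<close> halts in state \<open>s'\<close> after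
  \<open>t\<close> flops. A program that divides by zero gets stuck, hence does not halt.\<close>

inductive exec ::
    "(real \<Rightarrow> real) \<Rightarrow> (real \<Rightarrow> real) \<Rightarrow> prog \<Rightarrow> state \<Rightarrow> nat \<Rightarrow> state \<Rightarrow> bool"
  for g1 g2 :: "real \<Rightarrow> real" where
  Skip: "exec g1 g2 Skip s 0 s"
| ISet: "exec g1 g2 (ISet j a) (r, m) 0 (r(j := idx_val r a), m)"
| RConst: "exec g1 g2 (RConst a c) (r, m) 0 (r, m(idx_val r a := c))"
| RCopy: "exec g1 g2 (RCopy a b) (r, m) 0 (r, m(idx_val r a := m (idx_val r b)))"
| RArith: "(f = Div \<Longrightarrow> m (idx_val r c) \<noteq> 0) \<Longrightarrow>
    exec g1 g2 (RArith a f b c) (r, m) 1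
      (r, m(idx_val r a := arith_val f (m (idx_val r b)) (m (idx_val r c))))"
| REval: "exec g1 g2 (REval a f b) (r, m) 1
      (r, m(idx_val r a := oracle_val g1 g2 f (m (idx_val r b))))"
| Seq: "exec g1 g2 p s t s' \<Longrightarrow> exec g1 g2 q s' t' s'' \<Longrightarrow> exec g1 g2 (Seq p q) s (t + t') s''"
| Cond: "exec g1 g2 (if test_val b s then p else q) s t s' \<Longrightarrow>
    exec g1 g2 (Cond b p q) s (test_cost b + t) s'"
| WhileFalse: "\<not> test_val b s \<Longrightarrow> exec g1 g2 (While b p) s (test_cost b) s"
| WhileTrue: "test_val b s \<Longrightarrow> exec g1 g2 p s t s' \<Longrightarrow> exec g1 g2 (While b p) s' t' s'' \<Longrightarrow>
    exec g1 g2 (While b p) s (test_cost b + t + t') s''"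

text \<open>The input \<open>n\<close> is placed in index register \<open>0\<close> and \<open>\<epsilon>\<close> in memory cell \<open>0\<close>; the output is
  read from the memory cells \<open>1, \<dots>, n\<close>.\<close>

definition input_state :: "nat \<Rightarrow> real \<Rightarrow> state" where
  "input_state n \<epsilon> = ((\<lambda>_. 0)(0 := n), (\<lambda>_. 0)(0 := \<epsilon>))"

definition computes ::
    "(real \<Rightarrow> real) \<Rightarrow> (real \<Rightarrow> real) \<Rightarrow> prog \<Rightarrow> nat \<Rightarrow> real \<Rightarrow> nat \<Rightarrow> (nat \<Rightarrow> real) \<Rightarrow> bool" where
  "computes g1 g2 p n \<epsilon> t v \<longleftrightarrow>
     (\<exists>r m. exec g1 g2 p (input_state n \<epsilon>) t (r, m) \<and> (\<forall>k\<in>{1..n}. v k = m k))"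

text \<open>The program determines its output and its cost, so \<open>computes\<close> is a partial function
  of the input.\<close>

lemma exec_deterministic:
  assumes "exec g1 g2 p s t u" and "exec g1 g2 p s t' u'"
  shows "t' = t \<and> u' = u"
  using assms
proof (induction arbitrary: t' u' rule: exec.induct)
  case (Seq p s t s' q t2 s'')
  from Seq.prems show ?case by (cases rule: exec.cases) (use Seq.IH in blast)+
next
  case (Cond b s p q t s')
  from Cond.prems show ?case by (cases rule: exec.cases) (use Cond.IH in blast)+
next
  case (WhileFalse b s p)
  from WhileFalse.prems show ?case by (cases rule: exec.cases) (use WhileFalse.hyps in auto)
next
  case (WhileTrue b s p t s' t2 s'')
  from WhileTrue.prems show ?case
    by (cases rule: exec.cases) (use WhileTrue.hyps WhileTrue.IH in blast)+
qed (auto elim: exec.cases)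

end

theory Submission imports Defs begin

text \<open>
  The first \<open>n - 1\<close> equations determine \<open>U\<^sub>2, \<dots>, U\<^sub>n\<close> from \<open>x = U\<^sub>1\<close>, so the system is the single
  equation \<open>P x = 0\<close>, where \<open>P\<close> is the residual of the last equation. After summation, that
  equation reads \<open>S x = g\<^sub>2 (U\<^sub>n) / \<beta>\<close> with the trapezoidal sum \<open>S\<close> of \<open>g\<^sub>1\<close> along the trajectory, that
  is, \<open>F x = 1 / \<beta>\<close> for \<open>F = S / g\<^sub>2 (U\<^sub>n)\<close>.

  Convexity of \<open>g\<^sub>1\<close> implies that the logarithmic derivative of \<open>S\<close> is at most that of \<open>g\<^sub>1 (U\<^sub>n)\<close>
  (\<open>W_Q_comparison\<close>, a discrete Sturm comparison). Hence \<open>F' \<le> (S / g\<^sub>1 (U\<^sub>n)) * (g\<^sub>1 / g\<^sub>2)' (U\<^sub>n) < 0\<close>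
  (\<open>F'_le\<close>), which gives uniqueness. Moreover \<open>F\<close> is at most \<open>(g\<^sub>1 / g\<^sub>2) (U\<^sub>n)\<close>, and a discrete Gronwall
  inequality shows that it is at least a constant multiple of that quantity while \<open>U\<^sub>n\<close> stays bounded;
  this gives existence, and bounds on the root and on its trajectory that do not depend on \<open>n\<close>
  (\<open>root_exists\<close>).

  Initial values to the left of the root have smaller trajectories than the root, so on an interval
  \<open>[a, b]\<close> ending at the root the slope of \<open>P\<close> towards the root is bounded and bounded away from \<open>0\<close>, and
  its second derivative is bounded, uniformly in \<open>n\<close> (\<open>P_estimates\<close>). Therefore a fixed number of steps \<open>x + P x / (2 M)\<close> leads from \<open>a\<close> to
  within the range of quadratic convergence of Newton's method. A quadratic correction of the Newton step
  keeps the iterates to the left of the root (\<open>corrected_newton_bound\<close>), and about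
  \<open>log\<^sub>2 (log\<^sub>2 (1 / \<epsilon>))\<close> further steps suffice. Each evaluation of \<open>P\<close> and its derivative is one pass over
  the grid and takes \<open>O(n)\<close> flops.
\<close>

section \<open>Convex reaction rates\<close>

text \<open>A function vanishing at \<open>0\<close> that is strictly increasing and strictly convex on the positive
  half-line, packed together with its first two derivatives. The derivatives at \<open>0\<close> may vanish.\<close>

locale rate =
  fixes g g' g'' :: "real \<Rightarrow> real"
  assumes deriv_g: "(g has_real_derivative g' x) (at x)"
    and deriv_g': "(g' has_real_derivative g'' x) (at x)"
    and cont_g'': "continuous_on UNIV g''"
    and g_0: "g 0 = 0"
    and g'_pos: "x > 0 \<Longrightarrow> g' x > 0"
    and g''_pos: "x > 0 \<Longrightarrow> g'' x > 0"
begin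

lemma cont_g: "continuous_on A g"
  by (meson DERIV_isCont continuous_at_imp_continuous_on deriv_g)

lemma cont_g': "continuous_on A g'"
  by (meson DERIV_isCont continuous_at_imp_continuous_on deriv_g')

lemma g'_mono: assumes "0 \<le> x" "x \<le> y" shows "g' x \<le> g' y"
proof (cases "x = y")
  case False
  then obtain z where "x < z" "z < y" "g' y - g' x = (y - x) * g'' z"
    using MVT2[of x y g' g''] deriv_g' assms by auto
  then show ?thesis using g''_pos[of z] assms False
    by (smt (verit) mult_nonneg_nonneg)
qed simp

lemma g'_nonneg: "0 \<le> x \<Longrightarrow> 0 \<le> g' x"
proof -
  assume "0 \<le> x"
  have "0 \<le> g' 0"
  proof (rule tendsto_lowerbound)
    show "(g' \<longlongrightarrow> g' 0) (at_right 0)"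
      using deriv_g' DERIV_isCont isCont_def filterlim_at_split by blast
    show "\<forall>\<^sub>F x in at_right 0. 0 \<le> g' x"
      using g'_pos by (auto simp: eventually_at_right_less intro!: eventually_at_rightI[of 0 1] less_imp_le)
  qed simp
  then show ?thesis using g'_mono[of 0 x] \<open>0 \<le> x\<close> by simp
qed

lemma tangent_upper: assumes "0 \<le> x" "x \<le> y" shows "g y - g x \<le> g' y * (y - x)"
proof (cases "x = y")
  case False
  then obtain z where z: "x < z" "z < y" "g y - g x = (y - x) * g' z"
    using MVT2[of x y g g'] deriv_g assms by auto
  then show ?thesis using g'_mono[of z y] assms
    by (simp add: mult.commute mult_left_mono)
qed simp

lemma g_strict_mono: assumes "0 \<le> x" "x < y" shows "g x < g y"
proof -
  obtain z where z: "x < z" "z < y" "g y - g x = (y - x) * g' z"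
    using MVT2[of x y g g'] deriv_g assms by auto
  then show ?thesis using g'_pos[of z] assms
    by (smt (verit) mult_pos_pos)
qed

lemma g_mono: "0 \<le> x \<Longrightarrow> x \<le> y \<Longrightarrow> g x \<le> g y"
  using g_strict_mono[of x y] by (cases "x = y") auto

lemma g_nonneg: "0 \<le> x \<Longrightarrow> 0 \<le> g x"
  using g_mono[of 0 x] g_0 by simp

lemma g_pos: "0 < x \<Longrightarrow> 0 < g x"
  using g_strict_mono[of 0 x] g_0 by simp

lemma g_le_linear: assumes "0 \<le> x" "x \<le> R" shows "g x \<le> g' R * x"
proof -
  have "g x \<le> g' x * x" using tangent_upper[of 0 x] assms g_0 by simp
  also have "\<dots> \<le> g' R * x" using assms g'_mono by (intro mult_right_mono) auto
  finally show ?thesis .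
qed

lemma g''_bounded: "\<exists>A\<ge>0. \<forall>x\<in>{0..R}. \<bar>g'' x\<bar> \<le> A"
proof -
  have "compact (g'' ` {0..R})"
    by (intro compact_continuous_image continuous_on_subset[OF cont_g'']) auto
  then obtain A where "\<forall>x\<in>{0..R}. norm (g'' x) \<le> A"
    using compact_imp_bounded bounded_iff by (metis imageI)
  then show ?thesis by (intro exI[of _ "max A 0"]) force
qed

end

section \<open>The marching scheme\<close>

text \<open>The explicit scheme for \<open>y'' = f\<close> with step \<open>h\<close> and zero initial slope. The second component
  is the flux \<open>s\<^sub>k = f\<^sub>0/2 + f\<^sub>1 + \<dots> + f\<^sub>k\<close>, so that \<open>y\<^bsub>k+1\<^esub> = y\<^sub>k + h\<^sup>2 s\<^sub>k\<close>; this
  is the three-term recursion \<open>y\<^bsub>k+1\<^esub> - 2 y\<^sub>k + y\<^bsub>k-1\<^esub> = h\<^sup>2 f\<^sub>k\<close> started with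
  \<open>y\<^sub>1 - y\<^sub>0 = h\<^sup>2 f\<^sub>0 / 2\<close>. Grid points are counted from \<open>0\<close>, and the source term \<open>f k y\<close> may
  depend on the grid point, which covers the linearized equations.\<close>

fun march :: "real \<Rightarrow> (nat \<Rightarrow> real \<Rightarrow> real) \<Rightarrow> real \<Rightarrow> nat \<Rightarrow> real \<times> real" where
  "march h f y 0 = (y, f 0 y / 2)"
| "march h f y (Suc k) =
     (let z = fst (march h f y k) + h\<^sup>2 * snd (march h f y k)
      in (z, snd (march h f y k) + f (Suc k) z))"

lemma fst_march_mono:
  assumes y: "0 \<le> y" and f: "\<And>k z. 0 \<le> z \<Longrightarrow> 0 \<le> f k z"
  shows "i \<le> k \<Longrightarrow> fst (march h f y i) \<le> fst (march h f y k)"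
    and "0 \<le> snd (march h f y k)"
proof -
  have *: "0 \<le> fst (march h f y k) \<and> 0 \<le> snd (march h f y k)" for k
    by (induction k) (use y f in \<open>auto simp: Let_def intro!: add_nonneg_nonneg\<close>)
  then show "0 \<le> snd (march h f y k)" by blast
  show "fst (march h f y i) \<le> fst (march h f y k)" if "i \<le> k"
    using that by (rule lift_Suc_mono_le[rotated]) (use * in \<open>simp add: Let_def\<close>)
qed

lemma march_trapezoid:
  assumes "\<And>j. j \<le> k \<Longrightarrow> lo \<le> f j (fst (march h f y j))"
    and "\<And>j. j \<le> k \<Longrightarrow> f j (fst (march h f y j)) \<le> hi"
  shows "real k * lo \<le> snd (march h f y k) - f k (fst (march h f y k)) / 2"
    and "snd (march h f y k) - f k (fst (march h f y k)) / 2 \<le> real k * hi"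
proof -
  have "real j * lo \<le> snd (march h f y j) - f j (fst (march h f y j)) / 2
      \<and> snd (march h f y j) - f j (fst (march h f y j)) / 2 \<le> real j * hi" if "j \<le> k" for j
    using that
  proof (induction j)
    case (Suc j)
    have "lo \<le> f j (fst (march h f y j))" "f j (fst (march h f y j)) \<le> hi"
      "lo \<le> f (Suc j) (fst (march h f y (Suc j)))" "f (Suc j) (fst (march h f y (Suc j))) \<le> hi"
      using assms Suc.prems by (auto simp del: march.simps)
    with Suc show ?case by (auto simp: Let_def algebra_simps)
  qed simp
  then show "real k * lo \<le> snd (march h f y k) - f k (fst (march h f y k)) / 2"
    "snd (march h f y k) - f k (fst (march h f y k)) / 2 \<le> real k * hi" by auto
qed

lemma trapezoid_mean:
  assumes h: "0 < h" "h * real N = 1"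
    and "\<And>j. j \<le> N \<Longrightarrow> lo \<le> f j (fst (march h f y j))"
    and "\<And>j. j \<le> N \<Longrightarrow> f j (fst (march h f y j)) \<le> hi"
  shows "lo \<le> h * (snd (march h f y N) - f N (fst (march h f y N)) / 2)"
    and "h * (snd (march h f y N) - f N (fst (march h f y N)) / 2) \<le> hi"
proof -
  have "h * (real N * lo) \<le> h * (snd (march h f y N) - f N (fst (march h f y N)) / 2)"
    using march_trapezoid(1)[of N lo f h y hi] assms by (intro mult_left_mono) auto
  then show "lo \<le> h * (snd (march h f y N) - f N (fst (march h f y N)) / 2)"
    using h by (simp add: mult.assoc[symmetric])
  have "h * (snd (march h f y N) - f N (fst (march h f y N)) / 2) \<le> h * (real N * hi)"
    using march_trapezoid(2)[of N lo f h y hi] assms by (intro mult_left_mono) auto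
  then show "h * (snd (march h f y N) - f N (fst (march h f y N)) / 2) \<le> hi"
    using h by (simp add: mult.assoc[symmetric])
qed

lemma march_step_le:
  assumes h: "0 < h" "h * real N \<le> 1" and k: "k < N"
    and bounds: "\<And>j. j \<le> k \<Longrightarrow> 0 \<le> f j (fst (march h f y j))"
       "\<And>j. j \<le> k \<Longrightarrow> f j (fst (march h f y j)) \<le> hi"
  shows "h\<^sup>2 * snd (march h f y k) \<le> h * hi"
proof -
  have hi: "0 \<le> hi" using bounds(1)[of 0] bounds(2)[of 0] by linarith
  have "snd (march h f y k) \<le> real k * hi + hi / 2"
    using march_trapezoid(2)[of k 0 f h y hi] bounds by fastforce
  also have "\<dots> \<le> real N * hi" 
  proof -
    have "real k + 1/2 \<le> real N" using k by linarith
    then have "(real k + 1/2) * hi \<le> real N * hi" using hi by (rule mult_right_mono)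
    then show ?thesis by (simp add: algebra_simps)
  qed
  finally have "h * snd (march h f y k) \<le> h * real N * hi" using h by simp
  also have "\<dots> \<le> 1 * hi" using h hi by (intro mult_right_mono) auto
  finally show ?thesis using h by (simp add: power2_eq_square mult_left_mono)
qed

text \<open>A discrete Gronwall inequality: the bound \<open>exp K\<close> does not depend on the step size.\<close>

lemma geometric_growth:
  assumes h: "0 < h" "h * real N \<le> 1" and K: "0 \<le> K" and w0: "0 \<le> w 0"
    and step: "\<And>k. k < N \<Longrightarrow> w (Suc k) \<le> (1 + h * K) * w k"
  shows "k \<le> N \<Longrightarrow> w k \<le> exp K * w (0::nat)"
proof -
  assume k: "k \<le> N"
  have "w k \<le> (1 + h * K) ^ k * w 0" using k
  proof (induction k)
    case (Suc k)
    have "w (Suc k) \<le> (1 + h * K) * w k" using step Suc by auto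
    also have "\<dots> \<le> (1 + h * K) * ((1 + h * K) ^ k * w 0)"
      using Suc h K by (intro mult_left_mono) auto
    finally show ?case by (simp add: mult.assoc)
  qed simp
  also have "(1 + h * K) ^ k \<le> exp (h * K) ^ k"
    using h K by (intro power_mono exp_ge_add_one_self) auto
  also have "exp (h * K) ^ k = exp (real k * (h * K))" by (simp add: exp_of_nat_mult)
  also have "\<dots> \<le> exp K"
  proof -
    have "h * real k \<le> h * real N" using h k by (intro mult_left_mono) auto
    then have "h * real k * K \<le> 1 * K" using h K by (intro mult_right_mono) linarith+
    then show ?thesis by (simp add: mult_ac)
  qed
  finally show ?thesis using w0 by (simp add: mult_right_mono)
qed

lemma march_growth:
  assumes h: "0 < h" "h * real N \<le> 1" and K: "0 \<le> K" and A: "0 \<le> A" and y: "0 \<le> y"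
    and f: "\<And>k z. 0 \<le> z \<Longrightarrow> 0 \<le> f k z"
    and f_le: "\<And>k. k \<le> N \<Longrightarrow> f k (fst (march h f y k)) \<le> K * (A + fst (march h f y k))"
  shows "k \<le> N \<Longrightarrow> fst (march h f y k) \<le> exp K * (A + y)"
proof -
  assume k: "k \<le> N"
  have nonneg: "0 \<le> fst (march h f y k)" for k
    using fst_march_mono(1)[of y f 0 k h] y f by simp
  have "A + fst (march h f y k) \<le> exp K * (A + fst (march h f y 0))"
  proof (rule geometric_growth[OF h K _ _ k, of "\<lambda>k. A + fst (march h f y k)"])
    fix k assume k: "k < N"
    have "h\<^sup>2 * snd (march h f y k) \<le> h * (K * (A + fst (march h f y k)))"
    proof (rule march_step_le[OF h k])
      fix j assume j: "j \<le> k"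
      have "f j (fst (march h f y j)) \<le> K * (A + fst (march h f y j))" using f_le j k by auto
      also have "\<dots> \<le> K * (A + fst (march h f y k))"
        using K fst_march_mono(1)[of y f j k h] y f j by (intro mult_left_mono) auto
      finally show "f j (fst (march h f y j)) \<le> K * (A + fst (march h f y k))" .
    qed (use f nonneg in auto)
    then show "A + fst (march h f y (Suc k)) \<le> (1 + h * K) * (A + fst (march h f y k))"
      by (simp add: Let_def algebra_simps)
  qed (use A y in auto)
  then show ?thesis using A by simp
qed

section \<open>The trajectory as a function of its initial value\<close>

context rate begin

text \<open>\<open>U\<close> is the trajectory starting at \<open>x\<close> and \<open>Q\<close> its flux. The pairs \<open>V, W\<close> and \<open>Z, X\<close> solve the
  once and twice linearized recursions; they are the first and second derivatives of \<open>U, Q\<close> with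
  respect to \<open>x\<close>. Their source terms are \<open>fV\<close> and \<open>fZ\<close>.\<close>

abbreviation "U h x k \<equiv> fst (march h (\<lambda>_. g) x k)"
abbreviation "Q h x k \<equiv> snd (march h (\<lambda>_. g) x k)"
abbreviation "fV h x \<equiv> (\<lambda>k v. g' (U h x k) * v)"
abbreviation "V h x k \<equiv> fst (march h (fV h x) 1 k)"
abbreviation "W h x k \<equiv> snd (march h (fV h x) 1 k)"
abbreviation "fZ h x \<equiv> (\<lambda>k z. g'' (U h x k) * (V h x k)\<^sup>2 + g' (U h x k) * z)"
abbreviation "Z h x k \<equiv> fst (march h (fZ h x) 0 k)"
abbreviation "X h x k \<equiv> snd (march h (fZ h x) 0 k)"

lemma deriv_U:
  "((\<lambda>x. U h x k) has_real_derivative V h x k) (at x)"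
  "((\<lambda>x. Q h x k) has_real_derivative W h x k) (at x)"
proof -
  have "((\<lambda>x. U h x k) has_real_derivative V h x k) (at x)
      \<and> ((\<lambda>x. Q h x k) has_real_derivative W h x k) (at x)"
  proof (induction k)
    case (Suc k)
    have *: "((\<lambda>x. U h x k + h\<^sup>2 * Q h x k) has_real_derivative
        V h x k + h\<^sup>2 * W h x k) (at x)"
      using Suc by (auto intro!: derivative_eq_intros)
    from DERIV_chain2[OF deriv_g *] Suc * show ?case
      by (auto simp: Let_def intro!: DERIV_add)
  qed (auto intro!: derivative_eq_intros deriv_g)
  then show "((\<lambda>x. U h x k) has_real_derivative V h x k) (at x)"
    "((\<lambda>x. Q h x k) has_real_derivative W h x k) (at x)" by auto
qed

lemma deriv_V:
  "((\<lambda>x. V h x k) has_real_derivative Z h x k) (at x)"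
  "((\<lambda>x. W h x k) has_real_derivative X h x k) (at x)"
proof -
  have source: "((\<lambda>x. fV h x k (y x)) has_real_derivative
      g'' (U h x k) * V h x k * y x + g' (U h x k) * D) (at x)"
    if "(y has_real_derivative D) (at x)" for k y D
    using DERIV_mult[OF DERIV_chain2[OF deriv_g' deriv_U(1)] that, of h k]
    by (simp add: algebra_simps)
  have "((\<lambda>x. V h x k) has_real_derivative Z h x k) (at x)
      \<and> ((\<lambda>x. W h x k) has_real_derivative X h x k) (at x)"
  proof (induction k)
    case 0
    then show ?case using source[of "\<lambda>_. 1" 0 0] 
      by (auto intro!: derivative_eq_intros DERIV_cdivide)
  next
    case (Suc k)
    have *: "((\<lambda>x. V h x k + h\<^sup>2 * W h x k) has_real_derivative
        Z h x k + h\<^sup>2 * X h x k) (at x)"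
      using Suc by (auto intro!: derivative_eq_intros)
    from source[OF *, of "Suc k"] Suc * show ?case
      by (auto simp: Let_def power2_eq_square mult.assoc intro!: DERIV_add)
  qed
  then show "((\<lambda>x. V h x k) has_real_derivative Z h x k) (at x)"
    "((\<lambda>x. W h x k) has_real_derivative X h x k) (at x)" by auto
qed


lemma U_mono: "0 \<le> x \<Longrightarrow> i \<le> k \<Longrightarrow> U h x i \<le> U h x k"
  using fst_march_mono(1)[of x "\<lambda>_. g"] g_nonneg by blast

lemma U_ge: "0 \<le> x \<Longrightarrow> x \<le> U h x k"
  using U_mono[of x 0 k h] by simp

lemma Q_nonneg: "0 \<le> x \<Longrightarrow> 0 \<le> Q h x k"
  using fst_march_mono(2)[of x "\<lambda>_. g"] g_nonneg by blast

lemma fV_nonneg: "0 \<le> x \<Longrightarrow> 0 \<le> v \<Longrightarrow> 0 \<le> fV h x k v"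
  using g'_nonneg U_ge order_trans mult_nonneg_nonneg by metis

lemma V_mono: "0 \<le> x \<Longrightarrow> i \<le> k \<Longrightarrow> V h x i \<le> V h x k"
  by (rule fst_march_mono(1)) (use fV_nonneg in auto)

lemma V_ge_1: "0 \<le> x \<Longrightarrow> 1 \<le> V h x k"
  using V_mono[of x 0 k h] by simp

lemma W_nonneg: "0 \<le> x \<Longrightarrow> 0 \<le> W h x k"
  by (rule fst_march_mono(2)) (use fV_nonneg in auto)

lemma fZ_nonneg: "0 < x \<Longrightarrow> 0 \<le> z \<Longrightarrow> 0 \<le> fZ h x k z"
  using fV_nonneg[of x z h k] g''_pos[of "U h x k"] U_ge[of x h k]
  by (auto intro!: add_nonneg_nonneg)

lemma Z_mono: "0 < x \<Longrightarrow> i \<le> k \<Longrightarrow> Z h x i \<le> Z h x k"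
  by (rule fst_march_mono(1)) (use fZ_nonneg in auto)

lemma Z_nonneg: "0 < x \<Longrightarrow> 0 \<le> Z h x k"
  using Z_mono[of x 0 k h] by simp

lemma U_increment:
  assumes "0 \<le> x" "x < y"
  obtains z where "x < z" "z < y" "U h y k - U h x k = (y - x) * V h z k"
  using MVT2[of x y "\<lambda>x. U h x k" "\<lambda>x. V h x k"] deriv_U(1) assms by blast

lemma U_less: assumes "0 \<le> x" "x < y" shows "U h x k < U h y k"
proof -
  obtain z where z: "x < z" "z < y" "U h y k - U h x k = (y - x) * V h z k"
    by (rule U_increment[OF assms])
  have "0 < (y - x) * V h z k" using V_ge_1[of z h k] z assms by (intro mult_pos_pos) auto
  then show ?thesis using z by simp
qed

lemma U_le: "0 \<le> x \<Longrightarrow> x \<le> y \<Longrightarrow> U h x k \<le> U h y k"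
  using U_less[of x y h k] by (cases "x = y") auto

text \<open>The key inequality. In the limit of vanishing step size it says that \<open>v / g u\<close> is nonincreasing along
  the trajectory, where \<open>v\<close> is the linearization of \<open>u\<close>: by convexity of \<open>g\<close>, the function \<open>g u\<close> is
  a subsolution, \<open>(g u)'' \<ge> g' u * g u\<close>, of the equation \<open>v'' = g' u * v\<close>.\<close>

lemma W_Q_comparison:
  assumes "0 < x"
  shows "W h x k * g (U h x k) \<le> Q h x k * (g' (U h x k) * V h x k)"
proof (induction k)
  case 0
  then show ?case by simp
next
  case (Suc k)
  define u v q w u' v' where "u = U h x k" "v = V h x k" "q = Q h x k" "w = W h x k"
    "u' = U h x (Suc k)" "v' = V h x (Suc k)"
  note d = u_v_q_w_u'_v'_def
  have u': "u' = u + h\<^sup>2 * q" and v': "v' = v + h\<^sup>2 * w"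
    by (simp_all add: d Let_def)
  have pos: "0 \<le> u" "0 \<le> q" "0 \<le> w" "0 \<le> v" "u \<le> u'"
    using U_ge[of x h k] Q_nonneg[of x h k] W_nonneg[of x h k] V_ge_1[of x h k]
      U_mono[of x k "Suc k" h] assms unfolding d by linarith+
  \<comment> \<open>Convexity bounds the growth of \<open>g u\<close> from above, while \<open>v' = v + h\<^sup>2 w\<close> holds exactly.\<close>
  have "g u' \<le> g u + g' u' * (h\<^sup>2 * q)"
    using tangent_upper[of u u'] pos u' by simp
  then have "w * g u' \<le> w * (g u + g' u' * (h\<^sup>2 * q))" using pos by (intro mult_left_mono) auto
  also have "\<dots> = w * g u + w * g' u' * (h\<^sup>2 * q)" by (simp add: algebra_simps)
  also have "\<dots> \<le> q * (g' u * v) + w * g' u' * (h\<^sup>2 * q)" using Suc by (simp add: d)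
  also have "\<dots> \<le> q * (g' u' * v) + w * g' u' * (h\<^sup>2 * q)"
    using g'_mono[of u u'] pos by (intro add_right_mono mult_left_mono mult_right_mono) auto
  also have "\<dots> = q * (g' u' * v')" by (simp add: v' algebra_simps)
  finally have "(w + g' u' * v') * g u' \<le> (q + g u') * (g' u' * v')"
    by (simp add: algebra_simps)
  moreover have "W h x (Suc k) = w + g' u' * v'" "Q h x (Suc k) = q + g u'"
    by (simp_all add: d Let_def)
  ultimately show ?case by (simp only: d(5,6))
qed

text \<open>The trapezoidal sum of \<open>g\<close> along the trajectory on \<open>N\<close> cells, and its first two derivatives
  with respect to the initial value.\<close>

definition S where "S h N x = h * (Q h x N - g (U h x N) / 2)"
definition S' where "S' h N x = h * (W h x N - g' (U h x N) * V h x N / 2)"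
definition S'' where "S'' h N x = h * (X h x N - fZ h x N (Z h x N) / 2)"

lemma deriv_S: "(S h N has_real_derivative S' h N x) (at x)"
proof -
  have "((\<lambda>x. h * (Q h x N - g (U h x N) / 2)) has_real_derivative
    h * (W h x N - g' (U h x N) * V h x N / 2)) (at x)"
    by (intro DERIV_cmult DERIV_diff DERIV_cdivide deriv_U DERIV_chain2[OF deriv_g])
  then show ?thesis unfolding S'_def by (simp add: S_def[abs_def])
qed

lemma deriv_S': "(S' h N has_real_derivative S'' h N x) (at x)"
proof -
  have "((\<lambda>x. h * (W h x N - g' (U h x N) * V h x N / 2)) has_real_derivative
    h * (X h x N - (g'' (U h x N) * V h x N * V h x N + Z h x N * g' (U h x N)) / 2)) (at x)"
    by (intro DERIV_cmult DERIV_diff DERIV_cdivide DERIV_mult deriv_U deriv_V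
         DERIV_chain2[OF deriv_g'])
  moreover have "a * v * v + z * b = a * v\<^sup>2 + b * z" for a b v z :: real
    by (simp add: power2_eq_square)
  ultimately show ?thesis unfolding S''_def S'_def[abs_def] by (simp only:)
qed

lemma S'_S_comparison:
  assumes "0 < x" "0 \<le> h"
  shows "S' h N x * g (U h x N) \<le> S h N x * (g' (U h x N) * V h x N)"
  using mult_left_mono[OF W_Q_comparison[of x h N] assms(2)] assms
  by (simp add: S_def S'_def algebra_simps)

lemma S_bounds:
  assumes h: "0 < h" "h * real N = 1" and x: "0 \<le> x"
  shows "g x \<le> S h N x" "S h N x \<le> g (U h x N)"
  unfolding S_def
  using trapezoid_mean[OF h, of "g x" "\<lambda>_. g" x "g (U h x N)"] g_mono[OF x U_ge[OF x]]
    g_mono[OF order_trans[OF x U_ge[OF x]] U_mono[OF x]] by auto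

lemma U_le_exp:
  assumes h: "0 < h" "h * real N = 1" and x: "0 \<le> x" and R: "U h x N \<le> R"
  shows "U h x N \<le> exp (g' R) * x"
proof -
  have "0 \<le> R" using R U_ge[OF x, of h N] x by linarith
  have "U h x N \<le> exp (g' R) * (0 + x)"
  proof (rule march_growth[OF h(1)])
    fix k assume "k \<le> N"
    then have "U h x k \<le> R" using U_mono[OF x, of k N h] R by linarith
    then show "g (U h x k) \<le> g' R * (0 + U h x k)"
      using g_le_linear[of "U h x k" R] U_ge[OF x, of h k] x by simp
  qed (use h x g'_nonneg[OF \<open>0 \<le> R\<close>] g_nonneg in auto)
  then show ?thesis by simp
qed

text \<open>As long as the trajectory stays below \<open>R\<close>, the values of \<open>g\<close> along it are comparable up to a
  factor that depends on \<open>R\<close> only. This is what makes all later constants independent of the number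
  of grid points.\<close>

lemma g_U_le_exp:
  assumes h: "0 < h" "h * real N = 1" and x: "0 \<le> x" and R: "U h x N \<le> R"
  shows "g (U h x N) \<le> exp (g' R) * g x"
proof -
  have "0 \<le> R" using R U_ge[OF x, of h N] x by linarith
  have "g (U h x N) \<le> exp (g' R) * g (U h x 0)"
  proof (rule geometric_growth[OF h(1), of N _ "\<lambda>k. g (U h x k)"])
    fix k assume k: "k < N"
    have u: "0 \<le> U h x k" "U h x k \<le> U h x (Suc k)" "U h x (Suc k) \<le> R"
      using U_ge[OF x, of h k] U_mono[OF x, of k "Suc k" h] U_mono[OF x, of "Suc k" N h] R x k
      by linarith+
    have "g (U h x (Suc k)) - g (U h x k) \<le> g' (U h x (Suc k)) * (U h x (Suc k) - U h x k)"
      using u by (intro tangent_upper) auto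
    also have "\<dots> \<le> g' R * (U h x (Suc k) - U h x k)"
      using u g'_mono[of "U h x (Suc k)" R] by (intro mult_right_mono) linarith+
    also have "U h x (Suc k) - U h x k = h\<^sup>2 * Q h x k" by (simp add: Let_def)
    also have "g' R * (h\<^sup>2 * Q h x k) \<le> g' R * (h * g (U h x k))"
    proof (intro mult_left_mono march_step_le[OF h(1) _ k])
      show "g (U h x j) \<le> g (U h x k)" if "j \<le> k" for j
        using g_mono[OF order_trans[OF x U_ge[OF x]] U_mono[OF x that]] .
      show "0 \<le> g (U h x j)" for j
        using g_nonneg[OF order_trans[OF x U_ge[OF x]]] .
    qed (use h g'_nonneg[OF \<open>0 \<le> R\<close>] k in simp_all)
    finally show "g (U h x (Suc k)) \<le> (1 + h * g' R) * g (U h x k)"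
      by (simp add: distrib_right mult_ac del: march.simps)
  qed (use h x g_nonneg g'_nonneg[OF \<open>0 \<le> R\<close>] in auto)
  then show ?thesis by simp
qed

lemma V_le_exp:
  assumes h: "0 < h" "h * real N = 1" and x: "0 \<le> x" and R: "U h x N \<le> R" and k: "k \<le> N"
  shows "V h x k \<le> exp (g' R)"
proof -
  have "0 \<le> R" using R U_ge[OF x, of h N] x by linarith
  have "V h x k \<le> exp (g' R) * (0 + 1)"
  proof (rule march_growth[OF h(1) _ _ _ _ _ _ k])
    fix j assume "j \<le> N"
    then have "0 \<le> U h x j" "U h x j \<le> R" using U_mono[OF x, of j N h] U_ge[OF x, of h j] R x by linarith+
    then show "fV h x j (V h x j) \<le> g' R * (0 + V h x j)"
      using V_ge_1[OF x, of h j] g'_mono[of "U h x j" R] by (simp add: mult_right_mono)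
  qed (use h fV_nonneg[OF x] g'_nonneg[OF \<open>0 \<le> R\<close>] in auto)
  then show ?thesis by simp
qed

lemma S'_bounds:
  assumes h: "0 < h" "h * real N = 1" and x: "0 \<le> x" and R: "U h x N \<le> R"
  shows "0 \<le> S' h N x" "S' h N x \<le> g' R * exp (g' R)"
proof -
  have "0 \<le> fV h x j (V h x j) \<and> fV h x j (V h x j) \<le> g' R * exp (g' R)" if j: "j \<le> N" for j
  proof
    have u: "0 \<le> U h x j" "U h x j \<le> R" using U_mono[OF x, of j N h] U_ge[OF x, of h j] R x j by linarith+
    show "0 \<le> fV h x j (V h x j)" using V_ge_1[OF x, of h j] by (intro fV_nonneg x) simp
    show "fV h x j (V h x j) \<le> g' R * exp (g' R)"
      using u V_ge_1[OF x, of h j] g'_nonneg g'_mono V_le_exp[OF h x R j] by (intro mult_mono) auto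
  qed
  then show "0 \<le> S' h N x" "S' h N x \<le> g' R * exp (g' R)"
    unfolding S'_def using trapezoid_mean[OF h, of 0 "fV h x" 1 "g' R * exp (g' R)"] by auto
qed

text \<open>A single bound serves all step sizes.\<close>

lemma second_derivatives_bounded:
  assumes R: "0 < R"
  shows "\<exists>B\<ge>0. \<forall>h N x. 0 < h \<longrightarrow> h * real N = 1 \<longrightarrow> 0 < x \<longrightarrow> U h x N \<le> R \<longrightarrow>
    \<bar>Z h x N\<bar> \<le> B \<and> \<bar>S'' h N x\<bar> \<le> B"
proof -
  define K where "K = g' R"
  have K: "0 < K" using g'_pos R by (simp add: K_def)
  obtain A where A: "0 \<le> A" "\<And>u. u \<in> {0..R} \<Longrightarrow> \<bar>g'' u\<bar> \<le> A" using g''_bounded[of R] by blast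
  define C where "C = A * (exp K)\<^sup>2 / K"
  have C: "0 \<le> C" using A K by (simp add: C_def)
  define B where "B = max (exp K * C) (K * (C + exp K * C))"
  have main: "Z h x N \<le> exp K * C \<and> 0 \<le> S'' h N x \<and> S'' h N x \<le> K * (C + exp K * C)"
    if h: "0 < h" "h * real N = 1" and x: "0 < x" and U: "U h x N \<le> R" for h N x
  proof -
    have f_le: "fZ h x j z \<le> K * (C + z)" if j: "j \<le> N" and z: "0 \<le> z" for j z
    proof -
      have u: "0 \<le> U h x j" "U h x j \<le> R"
        using U_mono[of x j N h] U_ge[of x h j] U x j by linarith+
      have v: "1 \<le> V h x j" "V h x j \<le> exp K"
        using V_ge_1[of x h j] V_le_exp[OF h _ U j] x by (auto simp: K_def)
      have "g'' (U h x j) * (V h x j)\<^sup>2 \<le> A * (exp K)\<^sup>2"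
        using A(2)[of "U h x j"] u v A(1) by (intro mult_mono power_mono) auto
      moreover have "g' (U h x j) * z \<le> K * z"
        using u z g'_mono by (simp add: K_def mult_right_mono)
      ultimately show ?thesis using K by (simp add: C_def algebra_simps)
    qed
    have Zb: "Z h x j \<le> exp K * C" if "j \<le> N" for j
    proof -
      have "Z h x j \<le> exp K * (C + 0)"
        by (rule march_growth[OF h(1) _ _ _ _ _ _ that])
          (use h C K f_le fZ_nonneg[OF x] Z_nonneg[OF x] in auto)
      then show ?thesis by simp
    qed
    have "0 \<le> fZ h x j (Z h x j) \<and> fZ h x j (Z h x j) \<le> K * (C + exp K * C)" if j: "j \<le> N" for j
    proof
      show "0 \<le> fZ h x j (Z h x j)" by (intro fZ_nonneg Z_nonneg x)
      have "fZ h x j (Z h x j) \<le> K * (C + Z h x j)" by (intro f_le j Z_nonneg x)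
      also have "\<dots> \<le> K * (C + exp K * C)" using K Zb[OF j] by (intro mult_left_mono) auto
      finally show "fZ h x j (Z h x j) \<le> K * (C + exp K * C)" .
    qed
    then show ?thesis
      unfolding S''_def using Zb[of N] trapezoid_mean[OF h, of 0 "fZ h x" 0 "K * (C + exp K * C)"] by auto
  qed
  show ?thesis
  proof (intro exI[of _ B] conjI allI impI)
    show "0 \<le> B" using C by (simp add: B_def le_max_iff_disj)
    fix h N x assume "0 < h" "h * real N = 1" "0 < x" "U h x N \<le> R"
    with main[of h N x] Z_nonneg[of x h N] show "\<bar>Z h x N\<bar> \<le> B" "\<bar>S'' h N x\<bar> \<le> B"
      by (auto simp: B_def)
  qed
qed

end

section \<open>The shooting equation\<close>

text \<open>The condition \<open>wronskian_neg\<close> says that \<open>g\<^sub>1 / g\<^sub>2\<close> has negative derivative.\<close>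

locale reaction_problem =
  G1: rate g1 g1' g1'' + G2: rate g2 g2' g2''
  for g1 g1' g1'' g2 g2' g2'' :: "real \<Rightarrow> real" +
  fixes \<beta> :: real
  assumes \<beta>_pos: "\<beta> > 0"
    and wronskian_neg: "x > 0 \<Longrightarrow> g1' x * g2 x - g1 x * g2' x < 0"
    and ratio_surj: "(\<lambda>x. g1 x / g2 x) ` {0<..} = {0<..}"
begin

abbreviation "\<rho> x \<equiv> g1 x / g2 x"
abbreviation "\<rho>' x \<equiv> (g1' x * g2 x - g1 x * g2' x) / (g2 x)\<^sup>2"

lemma deriv_\<rho>: "x > 0 \<Longrightarrow> (\<rho> has_real_derivative \<rho>' x) (at x)"
  using DERIV_divide[OF G1.deriv_g[of x] G2.deriv_g[of x]] G2.g_pos[of x]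
  by (simp add: power2_eq_square)

lemma \<rho>'_neg: "x > 0 \<Longrightarrow> \<rho>' x < 0"
  using wronskian_neg[of x] G2.g_pos[of x] by (simp add: divide_neg_pos)

lemma \<rho>_strict_antimono: assumes "0 < x" "x < y" shows "\<rho> y < \<rho> x"
  by (rule DERIV_neg_imp_decreasing[OF assms(2)])
     (use deriv_\<rho> \<rho>'_neg assms in \<open>meson less_le_trans\<close>)

lemma \<rho>_le_iff: "0 < x \<Longrightarrow> 0 < y \<Longrightarrow> \<rho> x \<le> \<rho> y \<longleftrightarrow> y \<le> x"
  using \<rho>_strict_antimono[of x y] \<rho>_strict_antimono[of y x] by (cases x y rule: linorder_cases) auto

lemma U_pos: "0 < x \<Longrightarrow> 0 < G1.U h x N"
  using G1.U_ge[of x h N] by simp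

text \<open>The residual of the boundary condition at the right end, for the trajectory starting at \<open>x\<close>, up
  to the factor \<open>h\<close>; and its first two derivatives.\<close>

definition P where "P h N x = G1.S h N x - g2 (G1.U h x N) / \<beta>"
definition P' where "P' h N x = G1.S' h N x - g2' (G1.U h x N) * G1.V h x N / \<beta>"
definition P'' where "P'' h N x =
  G1.S'' h N x - (g2'' (G1.U h x N) * (G1.V h x N)\<^sup>2 + g2' (G1.U h x N) * G1.Z h x N) / \<beta>"

lemma deriv_P: "(P h N has_real_derivative P' h N x) (at x)"
  unfolding P'_def P_def[abs_def]
  by (intro DERIV_diff DERIV_cdivide G1.deriv_S DERIV_chain2[OF G2.deriv_g] G1.deriv_U)

lemma deriv_P': "(P' h N has_real_derivative P'' h N x) (at x)"
proof -
  have "((\<lambda>x. G1.S' h N x - g2' (G1.U h x N) * G1.V h x N / \<beta>) has_real_derivative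
    G1.S'' h N x - (g2'' (G1.U h x N) * G1.V h x N * G1.V h x N
      + G1.Z h x N * g2' (G1.U h x N)) / \<beta>) (at x)"
    by (intro DERIV_diff DERIV_cdivide DERIV_mult G1.deriv_S' G1.deriv_U G1.deriv_V
         DERIV_chain2[OF G2.deriv_g'])
  moreover have "a * v * v + z * b = a * v\<^sup>2 + b * z" for a b v z :: real
    by (simp add: power2_eq_square)
  ultimately show ?thesis unfolding P''_def P'_def[abs_def] by (simp only:)
qed

text \<open>The residual vanishes where \<open>F = 1 / \<beta>\<close>. Unlike \<open>P\<close>, the function \<open>F\<close> is monotone.\<close>

definition F where "F h N x = G1.S h N x / g2 (G1.U h x N)"
definition F' where "F' h N x =
  (G1.S' h N x * g2 (G1.U h x N) - G1.S h N x * (g2' (G1.U h x N) * G1.V h x N))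
    / (g2 (G1.U h x N))\<^sup>2"

lemma deriv_F: "x > 0 \<Longrightarrow> (F h N has_real_derivative F' h N x) (at x)"
  unfolding F'_def F_def[abs_def] power2_eq_square
  by (intro DERIV_divide G1.deriv_S DERIV_chain2[OF G2.deriv_g] G1.deriv_U)
     (use G2.g_pos[OF U_pos[of x h N]] in auto)

lemma P_eq_F: "x > 0 \<Longrightarrow> P h N x = g2 (G1.U h x N) * (F h N x - 1 / \<beta>)"
  using G2.g_pos[OF U_pos[of x h N]] by (simp add: P_def F_def algebra_simps)

lemma P_zero_iff: "x > 0 \<Longrightarrow> P h N x = 0 \<longleftrightarrow> F h N x = 1 / \<beta>"
  using P_eq_F[of x h N] G2.g_pos[OF U_pos[of x h N]] by auto

text \<open>The derivative of \<open>F\<close> is controlled by the derivative of \<open>\<rho>\<close> at the right end of the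
  trajectory, hence negative.\<close>

lemma F'_le:
  assumes h: "0 < h" "h * real N = 1" and x: "0 < x"
  shows "F' h N x \<le> G1.S h N x / g1 (G1.U h x N) * \<rho>' (G1.U h x N)"
proof -
  define u s s' v where "u = G1.U h x N" "s = G1.S h N x" "s' = G1.S' h N x" "v = G1.V h x N"
  note d = u_s_s'_v_def
  have u: "0 < u" using U_pos[OF x] by (simp add: d)
  have s: "0 \<le> s" using G1.S_bounds(1)[OF h, of x] x G1.g_nonneg[of x] by (simp add: d)
  have v: "1 \<le> v" using G1.V_ge_1 x by (simp add: d)
  have g: "0 < g1 u" "0 < g2 u" using u G1.g_pos G2.g_pos by auto
  have "s' * g1 u \<le> s * (g1' u * v)"
    using G1.S'_S_comparison[of x h N] x h by (simp add: d)
  then have "s' \<le> s * (g1' u * v) / g1 u" using g by (simp add: field_simps)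
  then have "s' * g2 u - s * (g2' u * v) \<le> s * (g1' u * v) / g1 u * g2 u - s * (g2' u * v)"
    using g by (intro diff_right_mono mult_right_mono) auto
  also have "\<dots> = s / g1 u * v * (g1' u * g2 u - g1 u * g2' u)" 
    using g by (simp add: field_simps)
  also have "\<dots> \<le> s / g1 u * (g1' u * g2 u - g1 u * g2' u)"
  proof -
    have "s / g1 u * (v - 1) * (g1' u * g2 u - g1 u * g2' u) \<le> 0"
      using wronskian_neg[OF u] s g v by (intro mult_nonneg_nonpos) auto
    moreover have "c * (v - 1) * w = c * v * w - c * w" for c w :: real
      by (simp add: algebra_simps)
    ultimately show ?thesis by (metis diff_le_0_iff_le)
  qed
  finally have "(s' * g2 u - s * (g2' u * v)) / (g2 u)\<^sup>2
      \<le> s / g1 u * (g1' u * g2 u - g1 u * g2' u) / (g2 u)\<^sup>2"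
    by (rule divide_right_mono) simp
  then show ?thesis unfolding F'_def d by simp
qed

lemma F_strict_antimono:
  assumes h: "0 < h" "h * real N = 1" and x: "0 < x" "x < y"
  shows "F h N y < F h N x"
proof (rule DERIV_neg_imp_decreasing[OF x(2)])
  fix z assume z: "x \<le> z"
  have "0 < G1.S h N z / g1 (G1.U h z N)"
    using G1.S_bounds(1)[OF h, of z] G1.g_pos[of z] G1.g_pos[OF U_pos[of z h N]] z x
    by (intro divide_pos_pos) linarith+
  then have "G1.S h N z / g1 (G1.U h z N) * \<rho>' (G1.U h z N) < 0"
    using \<rho>'_neg[OF U_pos[of z h N]] z x by (intro mult_pos_neg) auto
  then show "\<exists>y. (F h N has_real_derivative y) (at z) \<and> y < 0"
    using F'_le[OF h, of z] deriv_F[of z h N] z x by (intro exI[of _ "F' h N z"]) auto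
qed

lemma F_le: assumes h: "0 < h" "h * real N = 1" and x: "0 < x"
  shows "F h N x \<le> \<rho> (G1.U h x N)"
  unfolding F_def using G1.S_bounds(2)[OF h, of x] x G2.g_pos[OF U_pos[of x h N]]
  by (intro divide_right_mono) auto

lemma F_ge:
  assumes h: "0 < h" "h * real N = 1" and x: "0 < x" and R: "G1.U h x N \<le> R"
  shows "exp (- g1' R) * \<rho> (G1.U h x N) \<le> F h N x"
proof -
  have "exp (- g1' R) * g1 (G1.U h x N) \<le> g1 x"
    using G1.g_U_le_exp[OF h _ R] x by (simp add: exp_minus field_simps)
  also have "\<dots> \<le> G1.S h N x" using G1.S_bounds(1)[OF h, of x] x by simp
  finally have "exp (- g1' R) * g1 (G1.U h x N) / g2 (G1.U h x N) \<le> F h N x"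
    unfolding F_def using G2.g_pos[OF U_pos[OF x, of h N]] by (intro divide_right_mono) auto
  then show ?thesis by simp
qed

text \<open>The root is bracketed between the initial value \<open>c\<close> whose trajectory ends at \<open>r\<close> and the initial
  value \<open>R\<close>. The bounds on the root do not mention the step size.\<close>

lemma root_exists:
  assumes h: "0 < h" "h * real N = 1"
    and R: "0 < R" "\<rho> R = 1 / \<beta>" and r: "0 < r" "\<rho> r = exp (g1' R) / \<beta>"
  obtains b where "0 < b" "P h N b = 0" "G1.U h b N \<le> R" "exp (- g1' R) * r \<le> b"
    "\<And>x. 0 < x \<Longrightarrow> P h N x = 0 \<Longrightarrow> x = b"
proof -
  have "\<rho> R \<le> \<rho> r"
    using G1.g'_pos[OF R(1)] \<beta>_pos unfolding R r by (simp add: divide_right_mono)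
  then have rR: "r \<le> R" using \<rho>_le_iff R r by blast
  have "\<exists>c\<ge>0. c \<le> r \<and> G1.U h c N = r"
  proof (rule IVT')
    have "G1.U h 0 N = 0" using G1.U_le_exp[OF h order.refl order.refl] G1.U_ge[of 0 h N] by simp
    then show "G1.U h 0 N \<le> r" using r by simp
    show "r \<le> G1.U h r N" using G1.U_ge r by simp
    show "continuous_on {0..r} (\<lambda>x. G1.U h x N)"
      using G1.deriv_U(1) DERIV_isCont by (blast intro: continuous_at_imp_continuous_on)
  qed (use r in simp)
  then obtain c where c: "0 \<le> c" "c \<le> r" "G1.U h c N = r" by blast
  have c0: "0 < c"
  proof (rule ccontr)
    assume "\<not> 0 < c"
    then have "c = 0" using c by simp
    then show False
      using G1.U_le_exp[OF h order.refl order.refl] c r by simp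
  qed
  have "\<exists>b\<ge>c. b \<le> R \<and> F h N b = 1 / \<beta>"
  proof (rule IVT2')
    have "1 / \<beta> = exp (- g1' R) * \<rho> r" unfolding r by (simp add: exp_minus)
    then show "1 / \<beta> \<le> F h N c" using F_ge[OF h c0, of R] c rR by simp
    have "\<rho> (G1.U h R N) \<le> \<rho> R"
      using \<rho>_le_iff[OF U_pos R(1)] R(1) G1.U_ge[of R h N] by simp
    then show "F h N R \<le> 1 / \<beta>" using F_le[OF h R(1)] R by simp
    show "continuous_on {c..R} (F h N)"
      by (intro continuous_at_imp_continuous_on ballI DERIV_isCont[OF deriv_F]) (use c0 in auto)
  qed (use c rR in simp)
  then obtain b where b: "c \<le> b" "b \<le> R" "F h N b = 1 / \<beta>" by blast
  have b0: "0 < b" using b c0 by simp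
  show ?thesis
  proof
    show "0 < b" by fact
    show "P h N b = 0" using b b0 P_zero_iff by simp
    have "\<rho> R \<le> \<rho> (G1.U h b N)" using F_le[OF h b0] b R by simp
    then show UR: "G1.U h b N \<le> R" using \<rho>_le_iff[OF R(1) U_pos[OF b0]] by blast
    have "exp (- g1' R) * \<rho> (G1.U h b N) \<le> 1 / \<beta>" using F_ge[OF h b0 UR] b by simp
    then have "exp (g1' R) * (exp (- g1' R) * \<rho> (G1.U h b N)) \<le> exp (g1' R) * (1 / \<beta>)"
      by (rule mult_left_mono) simp
    then have "\<rho> (G1.U h b N) \<le> \<rho> r"
      unfolding r mult.assoc[symmetric] exp_add[symmetric] by simp
    then have "r \<le> G1.U h b N" using \<rho>_le_iff[OF U_pos[OF b0] r(1)] by blast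
    also have "\<dots> \<le> exp (g1' R) * b" using G1.U_le_exp[OF h _ UR] b0 by simp
    finally show "exp (- g1' R) * r \<le> b" by (simp add: exp_minus field_simps)
    show "x = b" if "0 < x" "P h N x = 0" for x
      using F_strict_antimono[OF h, of x b] F_strict_antimono[OF h, of b x] that b0 b P_zero_iff[of x h N]
      by (cases x b rule: linorder_cases) auto
  qed
qed

text \<open>Estimates on \<open>[a, b]\<close>, where \<open>b\<close> is the root: two linear bounds, and the Taylor remainder at the
  root. Only initial values to the left of the root are considered, since their trajectories stay
  below that of the root and hence below \<open>R\<close>.\<close>

lemma P_estimates:
  assumes a: "0 < a" "a \<le> R"
  shows "\<exists>m M L. 0 < m \<and> 0 < M \<and> 0 < L \<and>
    (\<forall>h N b x. 0 < h \<longrightarrow> h * real N = 1 \<longrightarrow> P h N b = 0 \<longrightarrow> G1.U h b N \<le> R \<longrightarrow> a \<le> x \<longrightarrow> x \<le> b \<longrightarrow>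
      m * (b - x) \<le> P h N x \<and> P h N x \<le> M * (b - x) \<and>
      \<bar>P h N x + P' h N x * (b - x)\<bar> \<le> L * (b - x)\<^sup>2)"
proof -
  define K where "K = g1' R"
  have R: "0 < R" using a by simp
  have K: "0 < K" using G1.g'_pos R by (simp add: K_def)
  have "\<exists>z\<in>{a..R}. \<forall>y\<in>{a..R}. \<rho>' y \<le> \<rho>' z"
  proof (rule continuous_attains_sup)
    show "continuous_on {a..R} \<rho>'"
      using G2.g_pos a
      by (intro continuous_intros G1.cont_g G1.cont_g' G2.cont_g G2.cont_g')
        (metis atLeastAtMost_iff less_le_trans less_irrefl zero_eq_power2)
  qed (use a in auto)
  then obtain z where z: "z \<in> {a..R}" "\<And>y. y \<in> {a..R} \<Longrightarrow> \<rho>' y \<le> \<rho>' z" by blast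
  define \<mu> where "\<mu> = - \<rho>' z"
  have \<mu>: "0 < \<mu>" "\<And>y. y \<in> {a..R} \<Longrightarrow> \<rho>' y \<le> - \<mu>"
    using \<rho>'_neg[of z] z a by (auto simp: \<mu>_def)
  define m where "m = g2 a * (exp (- K) * \<mu>)"
  define M where "M = K * exp K + g2' R * exp K / \<beta>"
  obtain B where B: "0 \<le> B" "\<And>h N x. 0 < h \<Longrightarrow> h * real N = 1 \<Longrightarrow> 0 < x \<Longrightarrow> G1.U h x N \<le> R \<Longrightarrow>
      \<bar>G1.Z h x N\<bar> \<le> B \<and> \<bar>G1.S'' h N x\<bar> \<le> B"
    using G1.second_derivatives_bounded[OF R] by blast
  obtain A where A: "0 \<le> A" "\<And>u. u \<in> {0..R} \<Longrightarrow> \<bar>g2'' u\<bar> \<le> A" using G2.g''_bounded[of R] by blast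
  define L where "L = B + (A * (exp K)\<^sup>2 + g2' R * B) / \<beta> + 1"
  have g2'R: "0 < g2' R" using G2.g'_pos R by simp
  have pos: "0 < m" "0 < M" "0 < L"
  proof -
    show "0 < m" using \<mu> G2.g_pos a by (simp add: m_def)
    show "0 < M" unfolding M_def using K g2'R \<beta>_pos by (intro add_pos_pos) auto
    have "0 \<le> (A * (exp K)\<^sup>2 + g2' R * B) / \<beta>" using A(1) B(1) g2'R \<beta>_pos by simp
    then show "0 < L" using B(1) by (simp add: L_def)
  qed
  have "m * (b - x) \<le> P h N x \<and> P h N x \<le> M * (b - x) \<and>
      \<bar>P h N x + P' h N x * (b - x)\<bar> \<le> L * (b - x)\<^sup>2"
    if h: "0 < h" "h * real N = 1" and b: "P h N b = 0" "G1.U h b N \<le> R" and x: "a \<le> x" "x \<le> b" for h N b x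
  proof (cases "x = b")
    case False
    then have xb: "x < b" using x by simp
    have U: "G1.U h y N \<in> {a..R}" "0 < y" if "x \<le> y" "y \<le> b" for y
      using G1.U_ge[of y h N] G1.U_le[of y b h N] that x a b by auto
    have V: "0 \<le> G1.V h y N" "G1.V h y N \<le> exp K" if "x \<le> y" "y \<le> b" for y
      using G1.V_ge_1[of y h N] G1.V_le_exp[OF h, of y R N] U[OF that] by (auto simp: K_def)
    have F': "F' h N y \<le> - (exp (- K) * \<mu>)" if "x \<le> y" "y \<le> b" for y
    proof -
      note U = U[OF that]
      have pos: "0 < g1 (G1.U h y N)" using G1.g_pos U a by auto
      have "exp (- K) * g1 (G1.U h y N) \<le> g1 y"
        using G1.g_U_le_exp[OF h, of y R] U by (simp add: K_def exp_minus field_simps)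
      also have "\<dots> \<le> G1.S h N y" using G1.S_bounds(1)[OF h, of y] U by simp
      finally have "exp (- K) \<le> G1.S h N y / g1 (G1.U h y N)"
        using pos by (simp add: field_simps)
      then have "G1.S h N y / g1 (G1.U h y N) * \<rho>' (G1.U h y N) \<le> exp (- K) * (- \<mu>)"
        using \<mu>(2)[OF U(1)] \<mu>(1) order_trans[OF less_imp_le[OF exp_gt_zero]]
        by (smt (verit, best) mult_left_mono mult_right_mono_neg exp_gt_zero)
      then show ?thesis using F'_le[OF h U(2)] by simp
    qed
    have lower: "m * (b - x) \<le> P h N x"
    proof -
      obtain \<xi> where \<xi>: "x < \<xi>" "\<xi> < b" "F h N b - F h N x = (b - x) * F' h N \<xi>"
        using MVT2[OF xb, of "F h N" "F' h N"] deriv_F U(2) by blast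
      have "(b - x) * F' h N \<xi> \<le> (b - x) * - (exp (- K) * \<mu>)"
        using F'[of \<xi>] \<xi> xb by (intro mult_left_mono) auto
      moreover have "F h N b = 1 / \<beta>" using P_zero_iff U(2) b x by blast
      ultimately have F: "exp (- K) * \<mu> * (b - x) \<le> F h N x - 1 / \<beta>"
        using \<xi> by (simp add: algebra_simps)
      have "g2 a * (exp (- K) * \<mu> * (b - x)) \<le> g2 (G1.U h x N) * (F h N x - 1 / \<beta>)"
        using U[of x] x a G2.g_mono G2.g_nonneg \<mu> xb F by (intro mult_mono) auto
      then show ?thesis using P_eq_F[of x h N] U[of x] x by (simp add: m_def mult.assoc)
    qed
    have P'_bound: "\<bar>P' h N y\<bar> \<le> M" if "x \<le> y" "y \<le> b" for y
    proof -
      note U = U[OF that] and V = V[OF that]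
      have "0 \<le> g2' (G1.U h y N)" "g2' (G1.U h y N) \<le> g2' R"
        using U a G2.g'_mono G2.g'_nonneg by auto
      then have "0 \<le> g2' (G1.U h y N) * G1.V h y N / \<beta>"
        "g2' (G1.U h y N) * G1.V h y N / \<beta> \<le> g2' R * exp K / \<beta>"
        using V \<beta>_pos by (auto intro!: divide_right_mono mult_mono)
      then show ?thesis
        using G1.S'_bounds[OF h, of y R] U unfolding P'_def M_def K_def by auto
    qed
    have P''_bound: "\<bar>P'' h N y\<bar> \<le> L" if "x \<le> y" "y \<le> b" for y
    proof -
      note U = U[OF that] and V = V[OF that]
      have Z: "\<bar>G1.Z h y N\<bar> \<le> B" "\<bar>G1.S'' h N y\<bar> \<le> B" using B(2)[OF h] U by auto
      have "\<bar>g2'' (G1.U h y N) * (G1.V h y N)\<^sup>2\<bar> \<le> A * (exp K)\<^sup>2"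
        unfolding abs_mult using A(2)[of "G1.U h y N"] U V A(1) a
        by (intro mult_mono) (auto intro!: power_mono)
      moreover have "\<bar>g2' (G1.U h y N) * G1.Z h y N\<bar> \<le> g2' R * B"
        unfolding abs_mult using Z U a g2'R G2.g'_mono G2.g'_nonneg by (intro mult_mono) auto
      ultimately have "\<bar>g2'' (G1.U h y N) * (G1.V h y N)\<^sup>2 + g2' (G1.U h y N) * G1.Z h y N\<bar>
          \<le> A * (exp K)\<^sup>2 + g2' R * B" by linarith
      then have "\<bar>(g2'' (G1.U h y N) * (G1.V h y N)\<^sup>2 + g2' (G1.U h y N) * G1.Z h y N) / \<beta>\<bar>
          \<le> (A * (exp K)\<^sup>2 + g2' R * B) / \<beta>"
        using \<beta>_pos by (simp add: divide_right_mono)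
      then show ?thesis using Z(2) unfolding P''_def L_def by linarith
    qed
    obtain \<xi> where \<xi>: "x < \<xi>" "\<xi> < b" "P h N b - P h N x = (b - x) * P' h N \<xi>"
      using MVT2[OF xb, of "P h N" "P' h N"] deriv_P by blast
    have upper: "P h N x \<le> M * (b - x)"
    proof -
      have "P h N x = (b - x) * - P' h N \<xi>" using \<xi> b by simp
      also have "\<dots> \<le> (b - x) * M" using P'_bound[of \<xi>] \<xi> by (intro mult_left_mono) auto
      finally show ?thesis by (simp add: mult.commute)
    qed
    obtain \<eta> where \<eta>: "x < \<eta>" "\<eta> < \<xi>" "P' h N \<xi> - P' h N x = (\<xi> - x) * P'' h N \<eta>"
      using MVT2[OF \<xi>(1), of "P' h N" "P'' h N"] deriv_P' by blast
    have "P h N x + P' h N x * (b - x) = - ((b - x) * (P' h N \<xi> - P' h N x))"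
      using \<xi>(3) b by (simp add: algebra_simps)
    then have "\<bar>P h N x + P' h N x * (b - x)\<bar> = (b - x) * ((\<xi> - x) * \<bar>P'' h N \<eta>\<bar>)"
      using \<xi> \<eta> by (simp add: abs_mult)
    also have "\<dots> \<le> (b - x) * ((b - x) * L)"
      using \<xi> \<eta> P''_bound[of \<eta>] by (intro mult_left_mono mult_mono) auto
    finally have "\<bar>P h N x + P' h N x * (b - x)\<bar> \<le> L * (b - x)\<^sup>2"
      by (simp add: power2_eq_square mult_ac)
    with lower upper show ?thesis by blast
  qed (use b in simp)
  with pos show ?thesis by blast
qed

text \<open>The constants are chosen before the number \<open>N\<close> of cells.\<close>

lemma uniform_root_data:
  obtains a m M L C c :: real where "0 < a" "0 < m" "0 < M" "0 < L" "0 < C"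
    "\<forall>h N. 0 < h \<longrightarrow> h * real N = 1 \<longrightarrow> (\<exists>b. a < b \<and> b \<le> c \<and> P h N b = 0 \<and>
       (\<forall>x>0. P h N x = 0 \<longrightarrow> x = b) \<and>
       (\<forall>x. a \<le> x \<longrightarrow> x \<le> b \<longrightarrow> m * (b - x) \<le> P h N x \<and> P h N x \<le> M * (b - x) \<and>
          \<bar>P h N x + P' h N x * (b - x)\<bar> \<le> L * (b - x)\<^sup>2 \<and>
          (\<forall>k\<le>N. \<bar>G1.U h x k - G1.U h b k\<bar> \<le> C * (b - x))))"
proof -
  have "1 / \<beta> \<in> \<rho> ` {0<..}" unfolding ratio_surj using \<beta>_pos by simp
  then obtain R where R: "0 < R" "\<rho> R = 1 / \<beta>" by fastforce
  have "exp (g1' R) / \<beta> \<in> \<rho> ` {0<..}" unfolding ratio_surj using \<beta>_pos by simp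
  then obtain r where r: "0 < r" "\<rho> r = exp (g1' R) / \<beta>" by fastforce
  \<comment> \<open>The factor \<open>1/2\<close> makes the starting point lie strictly to the left of the root.\<close>
  define a where "a = exp (- g1' R) * r / 2"
  have a: "0 < a" "a < exp (- g1' R) * r" using r by (simp_all add: a_def)
  have "\<rho> R \<le> \<rho> r"
    using G1.g'_pos[OF R(1)] \<beta>_pos unfolding R r by (simp add: divide_right_mono)
  then have rR: "r \<le> R" using \<rho>_le_iff R r by blast
  have "exp (- g1' R) * r \<le> 1 * r" using r G1.g'_pos[OF R(1)] by (intro mult_right_mono) auto
  then have aR: "a \<le> R" using a rR by simp
  from P_estimates[OF a(1) aR] obtain m M L where mML: "0 < m" "0 < M" "0 < L"
    "\<And>h N b x. 0 < h \<Longrightarrow> h * real N = 1 \<Longrightarrow> P h N b = 0 \<Longrightarrow> G1.U h b N \<le> R \<Longrightarrow> a \<le> x \<Longrightarrow> x \<le> b \<Longrightarrow>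
      m * (b - x) \<le> P h N x \<and> P h N x \<le> M * (b - x) \<and>
      \<bar>P h N x + P' h N x * (b - x)\<bar> \<le> L * (b - x)\<^sup>2" by metis
  show ?thesis
  proof (rule that[OF a(1) mML(1-3) exp_gt_zero[of "g1' R"]], intro allI impI)
    fix h :: real and N :: nat assume h: "0 < h" "h * real N = 1"
    obtain b where b: "0 < b" "P h N b = 0" "G1.U h b N \<le> R" "exp (- g1' R) * r \<le> b"
      "\<And>x. 0 < x \<Longrightarrow> P h N x = 0 \<Longrightarrow> x = b" using root_exists[OF h R r] by blast
    have U: "\<bar>G1.U h x k - G1.U h b k\<bar> \<le> exp (g1' R) * (b - x)" if "a \<le> x" "x \<le> b" "k \<le> N" for x k
    proof (cases "x = b")
      case False
      then have xb: "0 \<le> x" "x < b" using that a by auto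
      obtain z where z: "x < z" "z < b" "G1.U h b k - G1.U h x k = (b - x) * G1.V h z k"
        by (rule G1.U_increment[OF xb])
      have "G1.U h z N \<le> R" using G1.U_le[of z b h N] z xb b(3) by simp
      then have "(b - x) * G1.V h z k \<le> (b - x) * exp (g1' R)" "0 \<le> (b - x) * G1.V h z k"
        using G1.V_le_exp[OF h _ _ that(3), of z R] G1.V_ge_1[of z h k] z xb
        by (auto intro!: mult_left_mono)
      then show ?thesis using z(3) by (simp add: mult.commute)
    qed simp
    have "b \<le> R" using G1.U_ge[of b h N] b(1,3) by simp
    then show "\<exists>b. a < b \<and> b \<le> R \<and> P h N b = 0 \<and>
       (\<forall>x>0. P h N x = 0 \<longrightarrow> x = b) \<and>
       (\<forall>x. a \<le> x \<longrightarrow> x \<le> b \<longrightarrow> m * (b - x) \<le> P h N x \<and> P h N x \<le> M * (b - x) \<and>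
          \<bar>P h N x + P' h N x * (b - x)\<bar> \<le> L * (b - x)\<^sup>2 \<and>
          (\<forall>k\<le>N. \<bar>G1.U h x k - G1.U h b k\<bar> \<le> exp (g1' R) * (b - x)))"
    proof (intro exI[of _ b] conjI allI impI)
      show "a < b" using a b by simp
      show "x = b" if "0 < x" "P h N x = 0" for x using b that by blast
    qed (use b(2) U mML(4)[OF h b(2,3)] in blast)+
  qed
qed

end

section \<open>One step of the iteration\<close>

text \<open>In this section \<open>e\<close> is the distance of the iterate to the root on its right, and \<open>p\<close>, \<open>p'\<close> are the
  values of the residual and its derivative. The slow step moves the iterate by \<open>p / (2 M)\<close>.\<close>

lemma slow_step_bound:
  fixes e p m M :: real
  assumes "0 < e" "0 < M" "m * e \<le> p" "p \<le> M * e"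
  shows "0 < e - p / (2 * M)" "e - p / (2 * M) \<le> (1 - m / (2 * M)) * e"
proof -
  have "p / (2 * M) \<le> M * e / (2 * M)" using assms by (intro divide_right_mono) auto
  then show "0 < e - p / (2 * M)" using assms by simp
  have "m * e / (2 * M) \<le> p / (2 * M)" using assms by (intro divide_right_mono) auto
  then show "e - p / (2 * M) \<le> (1 - m / (2 * M)) * e" by (simp add: algebra_simps)
qed

text \<open>The Newton step \<open>- p / p'\<close> may overshoot the root by a multiple of \<open>e\<^sup>2\<close>. Moving back by the
  computable amount \<open>3 L p\<^sup>2 / m\<^sup>3\<close>, which is at least \<open>3 L e\<^sup>2 / m\<close>, keeps the iterate strictly to the
  left of the root and preserves quadratic convergence.\<close>

lemma corrected_newton_bound:
  fixes e p p' m M L :: real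
  assumes e: "0 < e" "L * e \<le> m / 2" and pos: "0 < m" "0 < L"
    and p: "m * e \<le> p" "p \<le> M * e" "\<bar>p + p' * e\<bar> \<le> L * e\<^sup>2"
  shows "p' < 0" "0 < e + p / p' + 3 * L / m ^ 3 * p\<^sup>2"
    "e + p / p' + 3 * L / m ^ 3 * p\<^sup>2 \<le> (2 * L / m + 3 * L * M\<^sup>2 / m ^ 3) * e\<^sup>2"
proof -
  have "p' * e \<le> L * e\<^sup>2 - m * e" using p by linarith
  also have "\<dots> = (L * e - m) * e" by (simp add: power2_eq_square algebra_simps)
  also have "\<dots> \<le> - (m / 2) * e" using e by (intro mult_right_mono) auto
  finally have p'_le: "p' \<le> - (m / 2)" using e by (metis mult_right_le_imp_le)
  then show p'_neg: "p' < 0" using pos by linarith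
  have "\<bar>e + p / p'\<bar> = \<bar>(p + p' * e) / p'\<bar>" using p'_neg by (simp add: add_divide_distrib add.commute)
  also have "\<dots> = \<bar>p + p' * e\<bar> / \<bar>p'\<bar>" by simp
  also have "\<dots> \<le> L * e\<^sup>2 / (m / 2)"
    using p p'_le pos by (intro frac_le) auto
  finally have newton: "\<bar>e + p / p'\<bar> \<le> 2 * L / m * e\<^sup>2" by (simp add: mult_ac)
  have "0 \<le> m * e" using pos e by simp
  then have sq: "(m * e)\<^sup>2 \<le> p\<^sup>2" "p\<^sup>2 \<le> (M * e)\<^sup>2" using p by (auto intro!: power_mono)
  have "3 * L / m * e\<^sup>2 = 3 * L / m ^ 3 * (m * e)\<^sup>2"
    using pos by (simp add: power2_eq_square power3_eq_cube)
  also have "\<dots> \<le> 3 * L / m ^ 3 * p\<^sup>2" using sq pos by (intro mult_left_mono) auto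
  finally have lo: "3 * L / m * e\<^sup>2 \<le> 3 * L / m ^ 3 * p\<^sup>2" .
  have "3 * L / m ^ 3 * p\<^sup>2 \<le> 3 * L / m ^ 3 * (M * e)\<^sup>2" using sq pos by (intro mult_left_mono) auto
  also have "\<dots> = 3 * L * M\<^sup>2 / m ^ 3 * e\<^sup>2" by (simp add: power_mult_distrib)
  finally have hi: "3 * L / m ^ 3 * p\<^sup>2 \<le> 3 * L * M\<^sup>2 / m ^ 3 * e\<^sup>2" .
  have "0 < L / m * e\<^sup>2" using pos e by simp
  moreover have "3 * L / m * e\<^sup>2 = 2 * L / m * e\<^sup>2 + L / m * e\<^sup>2"
    by (simp add: add_divide_distrib[symmetric] distrib_right[symmetric])
  ultimately show "0 < e + p / p' + 3 * L / m ^ 3 * p\<^sup>2" using newton lo by linarith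
  show "e + p / p' + 3 * L / m ^ 3 * p\<^sup>2 \<le> (2 * L / m + 3 * L * M\<^sup>2 / m ^ 3) * e\<^sup>2"
    using newton hi unfolding distrib_right by linarith
qed

text \<open>The least number of squarings that bring \<open>1/2\<close> down to at most \<open>\<epsilon>\<close>.\<close>

definition rounds :: "real \<Rightarrow> nat" where
  "rounds \<epsilon> = (LEAST j. (1/2) ^ (2 ^ j) \<le> \<epsilon>)"

lemma rounds_le: assumes "0 < \<epsilon>" shows "(1/2) ^ (2 ^ rounds \<epsilon>) \<le> \<epsilon>"
proof -
  obtain j where j: "(1/2::real) ^ j < \<epsilon>" using real_arch_pow_inv[of \<epsilon> "1/2"] assms by auto
  have "(1/2::real) ^ (2 ^ j) \<le> (1/2) ^ j" using less_exp[of j] by (intro power_decreasing) auto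
  with j have "(1/2) ^ (2 ^ j) \<le> \<epsilon>" by linarith
  then show ?thesis unfolding rounds_def by (rule LeastI)
qed

lemma less_rounds: "k < rounds \<epsilon> \<Longrightarrow> \<epsilon> < (1/2) ^ (2 ^ k)"
  unfolding rounds_def using not_less_Least by fastforce

lemma rounds_bound:
  assumes "0 < \<epsilon>" "\<epsilon> < 1" and "0 \<le> log 2 (log 2 (1 / \<epsilon>))"
  shows "real (rounds \<epsilon>) \<le> log 2 (log 2 (1 / \<epsilon>)) + 1"
proof (cases "rounds \<epsilon>")
  case (Suc j)
  then have "\<epsilon> < (1/2) ^ (2 ^ j)" by (intro less_rounds) simp
  then have "2 ^ (2 ^ j) \<le> 1 / \<epsilon>" using assms by (simp add: field_simps)
  then have "real (2 ^ j) \<le> log 2 (1 / \<epsilon>)"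
    using assms powr_realpow[of 2 "2 ^ j"] by (subst le_log_iff) (auto simp del: of_nat_power)
  then have "2 ^ j \<le> log 2 (1 / \<epsilon>)" by simp
  moreover have "0 < log 2 (1 / \<epsilon>)" using assms by (simp add: zero_less_log_cancel_iff)
  ultimately have "real j \<le> log 2 (log 2 (1 / \<epsilon>))"
    by (subst le_log_iff) (auto simp: powr_realpow)
  then show ?thesis using Suc by simp
qed (use assms in simp)

section \<open>Solutions of the system as trajectories\<close>

text \<open>The system has \<open>n = N + 1\<close> unknowns, indexed from \<open>1\<close>; the trajectory is indexed from \<open>0\<close>.\<close>

context reaction_problem begin

lemma solves_system_iff:
  assumes N: "N \<ge> 1"
  defines "h \<equiv> 1 / real N"
  shows "solves_system g1 g2 \<beta> (Suc N) u \<longleftrightarrow>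
    (\<forall>k\<le>N. u (Suc k) = G1.U h (u 1) k) \<and> P h N (u 1) = 0"
proof -
  have h: "0 < h" using N by (simp add: h_def)
  obtain M where M: "N = Suc M" using N by (cases N) auto
  have sys: "solves_system g1 g2 \<beta> (Suc N) u \<longleftrightarrow>
        0 = - (u 2 - u 1) + h\<^sup>2 / 2 * g1 (u 1) \<and>
        (\<forall>k\<in>{2..N}. 0 = - (u (k+1) - 2 * u k + u (k-1)) + h\<^sup>2 * g1 (u k)) \<and>
        0 = - (u N - u (Suc N)) - h * inverse \<beta> * g2 (u (Suc N)) + h\<^sup>2 / 2 * g1 (u (Suc N))"
    by (simp add: solves_system_def Let_def h_def)
  have last: "0 = - (u N - u (Suc N)) - h * inverse \<beta> * g2 (u (Suc N)) + h\<^sup>2 / 2 * g1 (u (Suc N))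
      \<longleftrightarrow> P h N (u 1) = 0" if U: "\<forall>k\<le>N. u (Suc k) = G1.U h (u 1) k"
  proof -
    have "u N = G1.U h (u 1) M" "u (Suc N) = G1.U h (u 1) N"
      using U[rule_format, of M] U[rule_format, of N] unfolding M by linarith+
    moreover have "G1.U h (u 1) N = G1.U h (u 1) M + h\<^sup>2 * G1.Q h (u 1) M"
      "G1.Q h (u 1) N = G1.Q h (u 1) M + g1 (G1.U h (u 1) N)"
      by (simp_all add: M Let_def)
    moreover have "- (p - q) - h * inverse \<beta> * c + h\<^sup>2 / 2 * w = h * (h * (s - w / 2) - c / \<beta>)"
      if "q = p + h\<^sup>2 * t" "s = t + w" for p q s t c w
      unfolding that by (simp add: algebra_simps power2_eq_square inverse_eq_divide)
    ultimately have "- (u N - u (Suc N)) - h * inverse \<beta> * g2 (u (Suc N)) + h\<^sup>2 / 2 * g1 (u (Suc N))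
        = h * P h N (u 1)"
      unfolding P_def G1.S_def by metis
    then show ?thesis using h by auto
  qed
  show ?thesis
  proof
    assume "solves_system g1 g2 \<beta> (Suc N) u"
    then have 1: "u 2 = u 1 + h\<^sup>2 * (g1 (u 1) / 2)"
      and 2: "\<And>k. 2 \<le> k \<Longrightarrow> k \<le> N \<Longrightarrow> u (Suc k) = 2 * u k - u (k - 1) + h\<^sup>2 * g1 (u k)"
      and 3: "0 = - (u N - u (Suc N)) - h * inverse \<beta> * g2 (u (Suc N)) + h\<^sup>2 / 2 * g1 (u (Suc N))"
      unfolding sys by (auto simp: algebra_simps)
    have "u (Suc k) = G1.U h (u 1) k \<and> u (Suc (Suc k)) = G1.U h (u 1) (Suc k)" if "k < N" for k
      using that
    proof (induction k)
      case 0
      then show ?case using 1 by (simp add: numeral_2_eq_2 Let_def)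
    next
      case (Suc k)
      have "u (Suc (Suc (Suc k))) = 2 * u (Suc (Suc k)) - u (Suc k) + h\<^sup>2 * g1 (u (Suc (Suc k)))"
        using 2[of "Suc (Suc k)"] Suc.prems by simp
      moreover have "G1.U h (u 1) (Suc k) = G1.U h (u 1) k + h\<^sup>2 * G1.Q h (u 1) k"
        by (simp add: Let_def)
      moreover have "G1.U h (u 1) (Suc (Suc k)) = G1.U h (u 1) (Suc k)
          + h\<^sup>2 * (G1.Q h (u 1) k + g1 (G1.U h (u 1) (Suc k)))"
        by (simp add: Let_def)
      ultimately show ?case using Suc by (simp add: algebra_simps del: march.simps)
    qed
    from this this[of M] have "\<forall>k\<le>N. u (Suc k) = G1.U h (u 1) k"
      unfolding M le_Suc_eq less_Suc_eq_le by blast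
    with last 3 show "(\<forall>k\<le>N. u (Suc k) = G1.U h (u 1) k) \<and> P h N (u 1) = 0" by blast
  next
    assume *: "(\<forall>k\<le>N. u (Suc k) = G1.U h (u 1) k) \<and> P h N (u 1) = 0"
    then have U: "u i = G1.U h (u 1) j" if "i = Suc j" "j \<le> N" for i j
      using that by blast
    have "u 2 = G1.U h (u 1) (Suc 0)" using N by (intro U) auto
    then have "0 = - (u 2 - u 1) + h\<^sup>2 / 2 * g1 (u 1)" by (simp add: Let_def)
    moreover have "0 = - (u (k+1) - 2 * u k + u (k-1)) + h\<^sup>2 * g1 (u k)" if k: "k \<in> {2..N}" for k
    proof -
      obtain j where j: "k = Suc (Suc j)" using k by (cases k; cases "k - 1") auto
      have "u (k + 1) = G1.U h (u 1) (Suc (Suc j))" "u k = G1.U h (u 1) (Suc j)"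
        "u (k - 1) = G1.U h (u 1) j" by (rule U, use k j in simp, use k j in simp)+
      moreover have "G1.U h (u 1) (Suc j) = G1.U h (u 1) j + h\<^sup>2 * G1.Q h (u 1) j"
        by (simp add: Let_def)
      moreover have "G1.U h (u 1) (Suc (Suc j)) = G1.U h (u 1) (Suc j)
          + h\<^sup>2 * (G1.Q h (u 1) j + g1 (G1.U h (u 1) (Suc j)))"
        by (simp add: Let_def)
      ultimately show ?thesis by (simp add: algebra_simps del: march.simps)
    qed
    ultimately show "solves_system g1 g2 \<beta> (Suc N) u" using * last sys by blast
  qed
qed

lemma positive_solution_eq:
  assumes N: "N \<ge> 1" and b: "0 < b" "P (1 / real N) N b = 0"
    "\<And>x. 0 < x \<Longrightarrow> P (1 / real N) N x = 0 \<Longrightarrow> x = b" and k: "k \<le> N"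
  shows "positive_solution g1 g2 \<beta> (Suc N) (Suc k) = G1.U (1 / real N) b k"
proof -
  define h where "h = 1 / real N"
  define w where "w = (\<lambda>i\<in>{1..Suc N}. G1.U h b (i - 1))"
  have w: "w (Suc k) = G1.U h b k" if "k \<le> N" for k using that by (simp add: w_def)
  have "positive_solution g1 g2 \<beta> (Suc N) = w"
    unfolding positive_solution_def
  proof (rule the_equality)
    have "solves_system g1 g2 \<beta> (Suc N) w"
      unfolding solves_system_iff[OF N] using w w[of 0] b(2) by (simp add: h_def)
    moreover have "w \<in> {1..Suc N} \<rightarrow>\<^sub>E {0<..}"
      unfolding w_def by (intro restrict_PiE_iff[THEN iffD2]) (use U_pos[OF b(1)] in auto)
    ultimately show "w \<in> {1..Suc N} \<rightarrow>\<^sub>E {0<..} \<and> solves_system g1 g2 \<beta> (Suc N) w" by blast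
  next
    fix u assume u: "u \<in> {1..Suc N} \<rightarrow>\<^sub>E {0<..} \<and> solves_system g1 g2 \<beta> (Suc N) u"
    then have U: "\<forall>k\<le>N. u (Suc k) = G1.U h (u 1) k" "P h N (u 1) = 0"
      unfolding solves_system_iff[OF N] h_def by blast+
    have "u 1 \<in> {0<..}" using u N by (intro PiE_mem[of u "{1..Suc N}"]) auto
    then have "u 1 = b" using b(3)[of "u 1"] U(2) by (simp add: h_def)
    show "u = w"
    proof (rule PiE_ext[of u "{1..Suc N}" "\<lambda>_. UNIV"])
      show "u \<in> {1..Suc N} \<rightarrow>\<^sub>E UNIV" using u by (auto simp: PiE_def)
      show "w \<in> {1..Suc N} \<rightarrow>\<^sub>E UNIV" by (simp add: w_def)
      fix i assume i: "i \<in> {1..Suc N}"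
      then obtain k where k: "i = Suc k" "k \<le> N" by (cases i) auto
      show "u i = w i" using U(1)[rule_format, OF k(2)] w[OF k(2)] unfolding k(1) \<open>u 1 = b\<close> by simp
    qed
  qed
  then show ?thesis using w k by (simp add: h_def)
qed

end

section \<open>Executing programs\<close>

text \<open>An interpreter for straight-line code that returns the cost and the final state. It yields
  \<^const>\<open>None\<close> on a division by zero and is not meant for \<^const>\<open>Skip\<close>, conditionals and loops,
  where it also yields \<^const>\<open>None\<close>. On concrete code the simplifier evaluates it
  symbolically.\<close>

fun run :: "(real \<Rightarrow> real) \<Rightarrow> (real \<Rightarrow> real) \<Rightarrow> prog \<Rightarrow> state \<Rightarrow> (nat \<times> state) option" where
  "run g1 g2 (ISet j a) (r, m) = Some (0, r(j := idx_val r a), m)"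
| "run g1 g2 (RConst a c) (r, m) = Some (0, r, m(idx_val r a := c))"
| "run g1 g2 (RCopy a b) (r, m) = Some (0, r, m(idx_val r a := m (idx_val r b)))"
| "run g1 g2 (RArith a f b c) (r, m) =
     (if f = Div \<and> m (idx_val r c) = 0 then None
      else Some (1, r, m(idx_val r a := arith_val f (m (idx_val r b)) (m (idx_val r c)))))"
| "run g1 g2 (REval a f b) (r, m) =
     Some (1, r, m(idx_val r a := oracle_val g1 g2 f (m (idx_val r b))))"
| "run g1 g2 (Seq p q) s =
     (case run g1 g2 p s of None \<Rightarrow> None
      | Some (t, s') \<Rightarrow> map_option (\<lambda>(t', s''). (t + t', s'')) (run g1 g2 q s'))"
| "run g1 g2 p s = None"

lemma exec_run: "run g1 g2 p s = Some (t, s') \<Longrightarrow> exec g1 g2 p s t s'"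
proof (induction g1 g2 p s arbitrary: t s' rule: run.induct)
  case (4 g1 g2 a f b c r m)
  then show ?case using exec.RArith[of f m r c g1 g2 a b] by (auto split: if_splits)
next
  case (5 g1 g2 a f b r m)
  then show ?case using exec.REval[of g1 g2 a f b r m] by auto
qed (auto intro: exec.intros split: option.splits)

text \<open>A loop whose body costs exactly \<open>c\<close> flops and that is known to run for exactly \<open>m\<close> rounds; the
  invariant is indexed by the round.\<close>

lemma exec_while_count:
  assumes step: "\<And>k s. k < m \<Longrightarrow> I k s \<Longrightarrow>
      test_val b s \<and> (\<exists>s'. exec g1 g2 p s c s' \<and> I (Suc k) s')"
    and stop: "\<And>s. I m s \<Longrightarrow> \<not> test_val b s"
    and init: "I 0 s"
  shows "\<exists>s'. exec g1 g2 (While b p) s (m * (test_cost b + c) + test_cost b) s' \<and> I m s'"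
proof -
  have "\<exists>s'. exec g1 g2 (While b p) s ((m - k) * (test_cost b + c) + test_cost b) s' \<and> I m s'"
    if "k \<le> m" "I k s" for k s
    using that
  proof (induction arbitrary: s rule: inc_induct)
    case base
    then show ?case using exec.WhileFalse[OF stop] by (intro exI[of _ s]) simp
  next
    case (step k)
    from assms(1)[OF step.hyps(2) step.prems] obtain s1 where
      s1: "test_val b s" "exec g1 g2 p s c s1" "I (Suc k) s1" by blast
    from step.IH[OF s1(3)] obtain s' where
      s': "exec g1 g2 (While b p) s1 ((m - Suc k) * (test_cost b + c) + test_cost b) s'" "I m s'"
      by blast
    have "test_cost b + c + ((m - Suc k) * (test_cost b + c) + test_cost b)
        = Suc (m - Suc k) * (test_cost b + c) + test_cost b" by simp
    also have "Suc (m - Suc k) = m - k" using step.hyps by simp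
    finally show ?case using exec.WhileTrue[OF s1(1,2) s'(1)] s'(2) by metis
  qed
  from this[of 0 s] init show ?thesis by simp
qed

section \<open>The shooting program\<close>

fun block :: "prog list \<Rightarrow> prog" where
  "block [] = Skip"
| "block [p] = p"
| "block (p # q # ps) = Seq p (block (q # ps))"

text \<open>Cells \<open>1, \<dots>, n\<close> hold the trajectory; scratch variables live in cells \<open>n + c\<close>:
  \<open>c = 1, 2\<close> hold \<open>h\<close> and \<open>h\<^sup>2\<close> (cell \<open>n + 1\<close> first accumulates \<open>n - 1\<close>);
  \<open>3\<close> the initial value \<open>x\<close>; \<open>4, 5, 6\<close> the quantities \<open>Q, V, W\<close>;
  \<open>7, 8\<close> finally the residual and its derivative; \<open>9\<close> the tolerance \<open>\<delta>\<close> that is squared in every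
  Newton round. Cell \<open>n + 10\<close> holds the constant \<open>1\<close>; cells \<open>7, 8, 11, 12\<close> also serve as temporaries. Index register \<open>1\<close> counts grid
  points, register \<open>2\<close> counts slow steps.\<close>

abbreviation reg :: "nat \<Rightarrow> idx" where "reg c \<equiv> IAdd (IReg 0) (INum c)"

text \<open>The real number \<open>n - 1\<close> is obtained by repeated addition, since indices cannot be converted into
  reals.\<close>

definition init_loop :: prog where
  "init_loop = While (ILess (IReg 1) (IReg 0))
     (block [RArith (reg 1) Add (reg 1) (reg 10), ISet 1 (IAdd (IReg 1) (INum 1))])"

definition init_prog :: "real \<Rightarrow> prog" where
  "init_prog a = block
    [block [RConst (reg 1) 0, RConst (reg 10) 1, ISet 1 (INum 1)],
     init_loop,
     block [RArith (reg 1) Div (reg 10) (reg 1), RArith (reg 2) Mul (reg 1) (reg 1),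
       RConst (reg 3) a, RConst (reg 9) (1/2)]]"

text \<open>Computes \<open>U\<close> together with its derivative \<open>V\<close>, and the fluxes \<open>Q\<close> and \<open>W\<close>, from \<open>x\<close>. On entry to the
  loop body, register \<open>1\<close> contains the index of the last cell that has been filled.\<close>

definition march_start :: prog where
  "march_start = block
    [RCopy (INum 1) (reg 3), RConst (reg 7) (1/2),
     REval (reg 4) G1 (INum 1), RArith (reg 4) Mul (reg 4) (reg 7),
     RConst (reg 5) 1,
     REval (reg 6) DG1 (INum 1), RArith (reg 6) Mul (reg 6) (reg 7),
     ISet 1 (INum 1)]"

definition march_body :: prog where
  "march_body = block
    [RArith (reg 7) Mul (reg 2) (reg 4),
     RArith (IAdd (IReg 1) (INum 1)) Add (IReg 1) (reg 7),
     RArith (reg 7) Mul (reg 2) (reg 6), RArith (reg 5) Add (reg 5) (reg 7),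
     ISet 1 (IAdd (IReg 1) (INum 1)),
     REval (reg 7) G1 (IReg 1), RArith (reg 4) Add (reg 4) (reg 7),
     REval (reg 7) DG1 (IReg 1), RArith (reg 7) Mul (reg 7) (reg 5),
     RArith (reg 6) Add (reg 6) (reg 7)]"

definition march_prog :: prog where
  "march_prog = Seq march_start (While (ILess (IReg 1) (IReg 0)) march_body)"

text \<open>Register \<open>0\<close> contains \<open>n\<close>, so it addresses the last value of the trajectory.\<close>

definition residual_prog :: "real \<Rightarrow> prog" where
  "residual_prog \<beta> = block
    [RConst (reg 11) (1/2), RConst (reg 12) (1/\<beta>),
     REval (reg 7) G1 (IReg 0), RArith (reg 7) Mul (reg 7) (reg 11),
     RArith (reg 7) Sub (reg 4) (reg 7), RArith (reg 7) Mul (reg 1) (reg 7),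
     REval (reg 8) G2 (IReg 0), RArith (reg 8) Mul (reg 8) (reg 12),
     RArith (reg 7) Sub (reg 7) (reg 8),
     REval (reg 8) DG1 (IReg 0), RArith (reg 8) Mul (reg 8) (reg 5),
     RArith (reg 8) Mul (reg 8) (reg 11),
     RArith (reg 8) Sub (reg 6) (reg 8), RArith (reg 8) Mul (reg 1) (reg 8),
     REval (reg 11) DG2 (IReg 0), RArith (reg 11) Mul (reg 11) (reg 5),
     RArith (reg 11) Mul (reg 11) (reg 12), RArith (reg 8) Sub (reg 8) (reg 11)]"

definition slow_step :: "real \<Rightarrow> prog" where
  "slow_step d = block
    [RConst (reg 11) d, RArith (reg 7) Mul (reg 11) (reg 7),
     RArith (reg 3) Add (reg 3) (reg 7), ISet 2 (IAdd (IReg 2) (INum 1))]"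

definition newton_step :: "real \<Rightarrow> prog" where
  "newton_step c = block
    [RConst (reg 11) c, RArith (reg 12) Mul (reg 7) (reg 7),
     RArith (reg 12) Mul (reg 11) (reg 12), RArith (reg 7) Div (reg 7) (reg 8),
     RArith (reg 3) Sub (reg 3) (reg 7), RArith (reg 3) Sub (reg 3) (reg 12),
     RArith (reg 9) Mul (reg 9) (reg 9)]"

text \<open>A fixed number \<open>J\<close> of slow steps, then Newton rounds while \<open>\<epsilon> < \<delta>\<close>, and a last pass that fills the
  output cells with the trajectory of the final iterate.\<close>

definition shooting_prog :: "real \<Rightarrow> real \<Rightarrow> nat \<Rightarrow> real \<Rightarrow> real \<Rightarrow> prog" where
  "shooting_prog \<beta> a J d c = block
    [init_prog a,
     While (ILess (IReg 2) (INum J)) (block [march_prog, residual_prog \<beta>, slow_step d]),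
     While (RLess (INum 0) (reg 9)) (block [march_prog, residual_prog \<beta>, newton_step c]),
     march_prog]"

section \<open>Correctness and cost of the parts of the program\<close>

text \<open>Programs evaluate the derivatives as \<^const>\<open>deriv\<close>, which fixes the parameters.\<close>

locale shooting = reaction_problem g1 "deriv g1" "deriv (deriv g1)" g2 "deriv g2" "deriv (deriv g2)" \<beta>
  for g1 g2 \<beta>
begin

text \<open>The part of the state that persists between the passes. Here \<open>N = n - 1\<close>.\<close>

definition env :: "nat \<Rightarrow> real \<Rightarrow> real \<Rightarrow> real \<Rightarrow> nat \<Rightarrow> state \<Rightarrow> bool" where
  "env N \<epsilon> x \<delta> j s \<longleftrightarrow> fst s 0 = Suc N \<and> fst s 2 = j \<and> snd s 0 = \<epsilon> \<and>
     snd s (Suc N + 1) = 1 / real N \<and> snd s (Suc N + 2) = (1 / real N)\<^sup>2 \<and>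
     snd s (Suc N + 3) = x \<and> snd s (Suc N + 9) = \<delta>"

text \<open>The marching pass has filled the cells up to grid point \<open>k\<close>.\<close>

definition marched :: "nat \<Rightarrow> real \<Rightarrow> nat \<Rightarrow> state \<Rightarrow> bool" where
  "marched N x k s \<longleftrightarrow> fst s 1 = Suc k \<and>
     snd s (Suc N + 4) = G1.Q (1 / real N) x k \<and> snd s (Suc N + 5) = G1.V (1 / real N) x k \<and>
     snd s (Suc N + 6) = G1.W (1 / real N) x k \<and>
     (\<forall>i\<le>k. snd s (Suc i) = G1.U (1 / real N) x i)"

lemma exec_march_start:
  assumes N: "N \<ge> 1" and e: "env N \<epsilon> x \<delta> j s"
  shows "\<exists>s'. exec g1 g2 march_start s 4 s' \<and> env N \<epsilon> x \<delta> j s' \<and> marched N x 0 s'"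
proof -
  obtain r m where s: "s = (r, m)" by (cases s)
  show ?thesis unfolding s
    by (intro exI conjI, rule exec_run)
      (use N e[unfolded s] in \<open>auto simp: march_start_def env_def marched_def\<close>)
qed

lemma exec_march_body:
  assumes N: "k < N" and e: "env N \<epsilon> x \<delta> j s" "marched N x k s"
  shows "\<exists>s'. exec g1 g2 march_body s 9 s' \<and> env N \<epsilon> x \<delta> j s' \<and> marched N x (Suc k) s'"
proof -
  obtain r m where s: "s = (r, m)" by (cases s)
  show ?thesis unfolding s
    by (intro exI conjI, rule exec_run)
      (use N e[unfolded s] in \<open>auto simp: march_body_def env_def marched_def Let_def le_Suc_eq mult_ac\<close>)
qed

lemma exec_march_prog:
  assumes N: "N \<ge> 1" and e: "env N \<epsilon> x \<delta> j s"
  shows "\<exists>s'. exec g1 g2 march_prog s (4 + 9 * N) s' \<and> env N \<epsilon> x \<delta> j s' \<and> marched N x N s'"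
proof -
  obtain s1 where s1: "exec g1 g2 march_start s 4 s1" "env N \<epsilon> x \<delta> j s1 \<and> marched N x 0 s1"
    using exec_march_start[OF N e] by blast
  have "\<exists>s'. exec g1 g2 (While (ILess (IReg 1) (IReg 0)) march_body) s1
      (N * (test_cost (ILess (IReg 1) (IReg 0)) + 9) + test_cost (ILess (IReg 1) (IReg 0))) s'
      \<and> (env N \<epsilon> x \<delta> j s' \<and> marched N x N s')"
  proof (rule exec_while_count[where I = "\<lambda>k s. env N \<epsilon> x \<delta> j s \<and> marched N x k s", OF _ _ s1(2)])
    fix k s assume k: "k < N" and I: "env N \<epsilon> x \<delta> j s \<and> marched N x k s"
    then show "test_val (ILess (IReg 1) (IReg 0)) s \<and>
        (\<exists>s'. exec g1 g2 march_body s 9 s' \<and> env N \<epsilon> x \<delta> j s' \<and> marched N x (Suc k) s')"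
      using exec_march_body[OF k] by (cases s) (auto simp: env_def marched_def)
  next
    fix s assume "env N \<epsilon> x \<delta> j s \<and> marched N x N s"
    then show "\<not> test_val (ILess (IReg 1) (IReg 0)) s"
      by (cases s) (auto simp: env_def marched_def)
  qed
  then obtain s' where "exec g1 g2 (While (ILess (IReg 1) (IReg 0)) march_body) s1 (9 * N) s'"
      "env N \<epsilon> x \<delta> j s' \<and> marched N x N s'"
    by (metis add_0 add.right_neutral mult.commute test_cost.simps(1))
  then show ?thesis using exec.Seq[OF s1(1)] unfolding march_prog_def by blast
qed

lemma exec_residual_prog:
  assumes e: "env N \<epsilon> x \<delta> j s" "marched N x N s"
  shows "\<exists>s'. exec g1 g2 (residual_prog \<beta>) s 16 s' \<and> env N \<epsilon> x \<delta> j s' \<and>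
     snd s' (Suc N + 7) = P (1 / real N) N x \<and> snd s' (Suc N + 8) = P' (1 / real N) N x"
proof -
  obtain r m where s: "s = (r, m)" by (cases s)
  show ?thesis unfolding s
    by (intro exI conjI, rule exec_run)
      (use e[unfolded s] in \<open>auto simp: residual_prog_def env_def marched_def P_def P'_def G1.S_def G1.S'_def\<close>)
qed

lemma exec_slow_step:
  assumes e: "env N \<epsilon> x \<delta> j s" 
  shows "\<exists>s'. exec g1 g2 (slow_step d) s 2 s' \<and> env N \<epsilon> (x + d * snd s (Suc N + 7)) \<delta> (Suc j) s'"
proof -
  obtain r m where s: "s = (r, m)" by (cases s)
  show ?thesis unfolding s
    by (intro exI conjI, rule exec_run)
      (use e[unfolded s] in \<open>auto simp: slow_step_def env_def\<close>)
qed

lemma exec_newton_step: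
  assumes e: "env N \<epsilon> x \<delta> j s" and "snd s (Suc N + 8) \<noteq> 0" 
  shows "\<exists>s'. exec g1 g2 (newton_step c) s 6 s' \<and>
    env N \<epsilon> (x - snd s (Suc N + 7) / snd s (Suc N + 8) - c * (snd s (Suc N + 7))\<^sup>2) (\<delta> * \<delta>) j s'"
proof -
  obtain r m where s: "s = (r, m)" by (cases s)
  show ?thesis unfolding s
    by (intro exI conjI, rule exec_run)
      (use assms[unfolded s] in \<open>auto simp: newton_step_def env_def power2_eq_square\<close>)
qed

lemma exec_init_prog:
  assumes N: "N \<ge> 1"
  shows "\<exists>s'. exec g1 g2 (init_prog a) (input_state (Suc N) \<epsilon>) (N + 2) s' \<and> env N \<epsilon> a (1/2) 0 s'"
proof -
  define I where "I k s \<longleftrightarrow> fst s 0 = Suc N \<and> fst s 1 = Suc k \<and> fst s 2 = 0 \<and> snd s 0 = \<epsilon> \<and>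
     snd s (Suc N + 1) = real k \<and> snd s (Suc N + 10) = 1" for k and s :: state
  define p1 where "p1 = block [RConst (reg 1) 0, RConst (reg 10) 1, ISet 1 (INum 1)]"
  define p2 where "p2 = block [RArith (reg 1) Div (reg 10) (reg 1),
    RArith (reg 2) Mul (reg 1) (reg 1), RConst (reg 3) a, RConst (reg 9) (1/2)]"
  obtain s1 where s1: "exec g1 g2 p1 (input_state (Suc N) \<epsilon>) 0 s1" "I 0 s1"
  proof -
    have "\<exists>s1. exec g1 g2 p1 (input_state (Suc N) \<epsilon>) 0 s1 \<and> I 0 s1"
      by (intro exI conjI, rule exec_run) (auto simp: p1_def input_state_def I_def)
    then show ?thesis using that by blast
  qed
  have "\<exists>s'. exec g1 g2 init_loop s1 (N * (test_cost (ILess (IReg 1) (IReg 0)) + 1)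
      + test_cost (ILess (IReg 1) (IReg 0))) s' \<and> I N s'"
    unfolding init_loop_def
  proof (rule exec_while_count[where I = I, OF _ _ s1(2)])
    fix k s assume k: "k < N" and I: "I k s"
    obtain r m where s: "s = (r, m)" by (cases s)
    show "test_val (ILess (IReg 1) (IReg 0)) s \<and>
      (\<exists>s'. exec g1 g2 (block [RArith (reg 1) Add (reg 1) (reg 10),
         ISet 1 (IAdd (IReg 1) (INum 1))]) s 1 s' \<and> I (Suc k) s')"
      unfolding s
      by (intro conjI exI, use k I[unfolded s] in \<open>simp add: I_def\<close>, rule exec_run)
        (use I[unfolded s] in \<open>auto simp: I_def\<close>)
  next
    fix s assume "I N s"
    then show "\<not> test_val (ILess (IReg 1) (IReg 0)) s" by (cases s) (auto simp: I_def)
  qed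
  then obtain s2 where s2: "exec g1 g2 init_loop s1 N s2" "I N s2" by auto
  obtain s3 where s3: "exec g1 g2 p2 s2 2 s3" "env N \<epsilon> a (1/2) 0 s3"
  proof -
    obtain r m where s: "s2 = (r, m)" by (cases s2)
    have "\<exists>s3. exec g1 g2 p2 s2 2 s3 \<and> env N \<epsilon> a (1/2) 0 s3"
      unfolding s by (intro exI conjI, rule exec_run)
        (use s2(2)[unfolded s] N in \<open>auto simp: p2_def env_def I_def power2_eq_square\<close>)
    then show ?thesis using that by blast
  qed
  have "init_prog a = Seq p1 (Seq init_loop p2)"
    unfolding init_prog_def p1_def p2_def by simp
  then show ?thesis
    using exec.Seq[OF s1(1) exec.Seq[OF s2(1) s3(1)]] s3(2) by (intro exI[of _ s3]) simp
qed

end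

section \<open>Convergence of the program\<close>

context shooting begin

lemma exec_slow_phase:
  assumes N: "N \<ge> 1" and aM: "0 < M" "0 < m" "a < b"
    and est: "\<And>x. a \<le> x \<Longrightarrow> x \<le> b \<Longrightarrow> m * (b - x) \<le> P (1 / real N) N x \<and> P (1 / real N) N x \<le> M * (b - x)"
    and start: "env N \<epsilon> a \<delta> 0 s"
  shows "\<exists>s' x. exec g1 g2 (While (ILess (IReg 2) (INum J))
        (block [march_prog, residual_prog \<beta>, slow_step (1 / (2 * M))])) s (J * (9 * N + 22)) s' \<and>
      env N \<epsilon> x \<delta> J s' \<and> a \<le> x \<and> x < b \<and> b - x \<le> (1 - m / (2 * M)) ^ J * (b - a)"
proof -
  define q where "q = 1 - m / (2 * M)"
  define I where "I j s \<longleftrightarrow> (\<exists>x. env N \<epsilon> x \<delta> j s \<and> a \<le> x \<and> x < b \<and> b - x \<le> q ^ j * (b - a))" for j s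
  have "m * (b - a) \<le> M * (b - a)" using est[of a] aM by linarith
  then have "m \<le> M" using aM by simp
  then have q: "0 \<le> q" using aM by (simp add: q_def field_simps)
  let ?t = "ILess (IReg 2) (INum J)"
  let ?p = "block [march_prog, residual_prog \<beta>, slow_step (1 / (2 * M))]"
  have "\<exists>s'. exec g1 g2 (While ?t ?p) s (J * (test_cost ?t + (9 * N + 22)) + test_cost ?t) s' \<and> I J s'"
  proof (rule exec_while_count[where I = I])
    fix j s assume j: "j < J" and "I j s"
    then obtain x where x: "env N \<epsilon> x \<delta> j s" "a \<le> x" "x < b" "b - x \<le> q ^ j * (b - a)"
      unfolding I_def by blast
    obtain s1 where s1: "exec g1 g2 march_prog s (4 + 9 * N) s1" "env N \<epsilon> x \<delta> j s1" "marched N x N s1"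
      using exec_march_prog[OF N x(1)] by blast
    obtain s2 where s2: "exec g1 g2 (residual_prog \<beta>) s1 16 s2" "env N \<epsilon> x \<delta> j s2"
      "snd s2 (Suc N + 7) = P (1 / real N) N x"
      using exec_residual_prog[OF s1(2,3)] by blast
    define x' where "x' = x + 1 / (2 * M) * P (1 / real N) N x"
    obtain s3 where s3: "exec g1 g2 (slow_step (1 / (2 * M))) s2 2 s3" "env N \<epsilon> x' \<delta> (Suc j) s3"
      using exec_slow_step[OF s2(2), of "1 / (2 * M)"] unfolding s2(3) x'_def by blast
    have P: "m * (b - x) \<le> P (1 / real N) N x" "P (1 / real N) N x \<le> M * (b - x)"
      using est[of x] x by auto
    have x': "b - x' = (b - x) - P (1 / real N) N x / (2 * M)" by (simp add: x'_def)
    have "0 \<le> P (1 / real N) N x" using P(1) x aM by (smt (verit) mult_nonneg_nonneg)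
    then have "x \<le> x'" using aM by (simp add: x'_def)
    moreover have "x' < b" "b - x' \<le> q * (b - x)"
      using slow_step_bound[OF _ aM(1) P] x(3) unfolding x'[symmetric] q_def by auto
    moreover have "q * (b - x) \<le> q * (q ^ j * (b - a))" using x(4) q by (rule mult_left_mono)
    ultimately have "I (Suc j) s3"
      unfolding I_def using s3(2) x(2) by (intro exI[of _ x']) (auto simp: mult.assoc)
    moreover have "exec g1 g2 ?p s (9 * N + 22) s3"
      using exec.Seq[OF s1(1) exec.Seq[OF s2(1) s3(1)]] by (simp add: add_ac)
    moreover have "test_val ?t s" using x(1) j by (cases s) (auto simp: env_def)
    ultimately show "test_val ?t s \<and> (\<exists>s'. exec g1 g2 ?p s (9 * N + 22) s' \<and> I (Suc j) s')" by blast
  next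
    fix s assume "I J s"
    then show "\<not> test_val ?t s" by (cases s) (auto simp: I_def env_def)
  next
    show "I 0 s" unfolding I_def using start aM by (intro exI[of _ a]) auto
  qed
  then show ?thesis unfolding I_def q_def by simp
qed

text \<open>After \<open>j\<close> rounds the scaled error \<open>C * (b - x)\<close> is at most \<open>(1/2) ^ (2 ^ j)\<close>, the current value of
  \<open>\<delta>\<close>; so the number of rounds depends on \<open>\<epsilon>\<close> only.\<close>

lemma exec_newton_phase:
  assumes N: "N \<ge> 1" and pos: "0 < m" "0 < L"
    and C: "2 * L / m + 3 * L * M\<^sup>2 / m ^ 3 \<le> C"
    and est: "\<And>x. a \<le> x \<Longrightarrow> x \<le> b \<Longrightarrow> m * (b - x) \<le> P (1 / real N) N x \<and> P (1 / real N) N x \<le> M * (b - x)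
       \<and> \<bar>P (1 / real N) N x + P' (1 / real N) N x * (b - x)\<bar> \<le> L * (b - x)\<^sup>2"
    and start: "env N \<epsilon> x0 (1/2) J s" "a \<le> x0" "x0 < b" "C * (b - x0) \<le> 1/2" and \<epsilon>: "0 < \<epsilon>"
  shows "\<exists>s' x \<delta>. exec g1 g2 (While (RLess (INum 0) (reg 9))
        (block [march_prog, residual_prog \<beta>, newton_step (3 * L / m ^ 3)])) s
          (rounds \<epsilon> * (9 * N + 27) + 1) s' \<and>
      env N \<epsilon> x \<delta> J s' \<and> a \<le> x \<and> x < b \<and> C * (b - x) \<le> \<epsilon>"
proof -
  define I where "I j s \<longleftrightarrow> (\<exists>x. env N \<epsilon> x ((1/2) ^ (2 ^ j)) J s \<and> a \<le> x \<and> x < b \<and>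
      C * (b - x) \<le> (1/2) ^ (2 ^ j))" for j s
  have C_ge: "2 * L / m \<le> C"
  proof -
    have "0 \<le> 3 * L * M\<^sup>2 / m ^ 3" using pos by simp
    then show ?thesis using C by linarith
  qed
  have "0 < 2 * L / m" using pos by simp
  then have C_pos: "0 < C" using C_ge by linarith
  let ?t = "RLess (INum 0) (reg 9)"
  let ?p = "block [march_prog, residual_prog \<beta>, newton_step (3 * L / m ^ 3)]"
  have "\<exists>s'. exec g1 g2 (While ?t ?p) s (rounds \<epsilon> * (test_cost ?t + (9 * N + 26)) + test_cost ?t) s'
      \<and> I (rounds \<epsilon>) s'"
  proof (rule exec_while_count[where I = I])
    fix j s assume j: "j < rounds \<epsilon>" and "I j s"
    then obtain x where x: "env N \<epsilon> x ((1/2) ^ (2 ^ j)) J s" "a \<le> x" "x < b"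
      "C * (b - x) \<le> (1/2) ^ (2 ^ j)"
      unfolding I_def by blast
    define p where "p = P (1 / real N) N x"
    define p' where "p' = P' (1 / real N) N x"
    define x' where "x' = x - p / p' - 3 * L / m ^ 3 * p\<^sup>2"
    have P: "m * (b - x) \<le> p" "p \<le> M * (b - x)" "\<bar>p + p' * (b - x)\<bar> \<le> L * (b - x)\<^sup>2"
      using est[of x] x by (auto simp: p_def p'_def)
    have "(1/2::real) ^ (2 ^ j) \<le> (1/2) ^ 1" by (intro power_decreasing) auto
    then have "C * (b - x) \<le> 1/2" using x(4) by simp
    moreover have "2 * L / m * (b - x) \<le> C * (b - x)" using C_ge x(3) by (intro mult_right_mono) auto
    ultimately have "2 * L / m * (b - x) \<le> 1/2" by linarith
    then have small: "L * (b - x) \<le> m / 2" using pos x(3) by (simp add: field_simps)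
    have x': "b - x' = (b - x) + p / p' + 3 * L / m ^ 3 * p\<^sup>2" by (simp add: x'_def)
    have e: "0 < b - x" using x by simp
    note newton = corrected_newton_bound[OF e small pos P, folded x']
    obtain s1 where s1: "exec g1 g2 march_prog s (4 + 9 * N) s1"
        "env N \<epsilon> x ((1/2) ^ (2 ^ j)) J s1" "marched N x N s1"
      using exec_march_prog[OF N x(1)] by blast
    obtain s2 where s2: "exec g1 g2 (residual_prog \<beta>) s1 16 s2" "env N \<epsilon> x ((1/2) ^ (2 ^ j)) J s2"
      "snd s2 (Suc N + 7) = p" "snd s2 (Suc N + 8) = p'"
      using exec_residual_prog[OF s1(2,3)] unfolding p_def p'_def by blast
    have "snd s2 (Suc N + 8) \<noteq> 0" using s2(4) newton(1) by simp
    from exec_newton_step[OF s2(2) this, of "3 * L / m ^ 3"] obtain s3 where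
      s3: "exec g1 g2 (newton_step (3 * L / m ^ 3)) s2 6 s3"
        "env N \<epsilon> x' ((1/2) ^ (2 ^ j) * (1/2) ^ (2 ^ j)) J s3"
      unfolding s2(3,4) x'_def by blast
    have sq: "(1/2::real) ^ (2 ^ j) * (1/2) ^ (2 ^ j) = (1/2) ^ (2 ^ Suc j)"
      by (simp only: power_add[symmetric] power_Suc mult_2)
    have "C * (b - x') \<le> C * (C * (b - x)\<^sup>2)"
    proof (intro mult_left_mono)
      show "b - x' \<le> C * (b - x)\<^sup>2"
        using newton(3) mult_right_mono[OF C, of "(b - x)\<^sup>2"] by simp
    qed (use C_pos in simp)
    also have "\<dots> = (C * (b - x)) * (C * (b - x))" by (simp add: power2_eq_square)
    also have "\<dots> \<le> (1/2) ^ (2 ^ j) * (1/2) ^ (2 ^ j)"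
      using x C_pos by (intro mult_mono) auto
    finally have "C * (b - x') \<le> (1/2) ^ (2 ^ Suc j)" unfolding sq .
    moreover have "a \<le> x'" 
    proof -
      have "C * (b - x) * (C * (b - x)) \<le> 1 * (C * (b - x))"
        using \<open>C * (b - x) \<le> 1/2\<close> x C_pos by (intro mult_right_mono) auto
      then have "C * (b - x') \<le> C * (b - x)"
        using \<open>C * (b - x') \<le> C * (C * (b - x)\<^sup>2)\<close> by (simp add: power2_eq_square mult_ac)
      then show ?thesis using C_pos x(2) by simp
    qed
    ultimately have "I (Suc j) s3"
      unfolding I_def using s3(2) newton(2) unfolding sq by (intro exI[of _ x']) auto
    moreover have "exec g1 g2 ?p s (9 * N + 26) s3"
      using exec.Seq[OF s1(1) exec.Seq[OF s2(1) s3(1)]] by (simp add: add_ac)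
    moreover have "test_val ?t s" using x(1) less_rounds[OF j] by (cases s) (auto simp: env_def)
    ultimately show "test_val ?t s \<and> (\<exists>s'. exec g1 g2 ?p s (9 * N + 26) s' \<and> I (Suc j) s')" by blast
  next
    fix s assume "I (rounds \<epsilon>) s"
    then show "\<not> test_val ?t s" using rounds_le[OF \<epsilon>] by (cases s) (auto simp: I_def env_def)
  next
    show "I 0 s" unfolding I_def using start by (intro exI[of _ x0]) auto
  qed
  moreover have "rounds \<epsilon> * (test_cost ?t + (9 * N + 26)) + test_cost ?t = rounds \<epsilon> * (9 * N + 27) + 1"
    by simp
  ultimately obtain s' where
    s': "exec g1 g2 (While ?t ?p) s (rounds \<epsilon> * (9 * N + 27) + 1) s'" "I (rounds \<epsilon>) s'"
    by metis
  then obtain x where "env N \<epsilon> x ((1/2) ^ (2 ^ rounds \<epsilon>)) J s'" "a \<le> x" "x < b"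
    "C * (b - x) \<le> (1/2) ^ (2 ^ rounds \<epsilon>)" unfolding I_def by blast
  with s'(1) rounds_le[OF \<epsilon>] show ?thesis by (meson order_trans)
qed

lemma shooting_prog_correct:
  "\<exists>p J. \<forall>N\<ge>1. \<forall>\<epsilon>>0. \<exists>r m.
     exec g1 g2 p (input_state (Suc N) \<epsilon>)
       (N + 2 + (J * (9 * N + 22) + (rounds \<epsilon> * (9 * N + 27) + 1 + (4 + 9 * N)))) (r, m) \<and>
     (\<forall>k\<le>N. \<bar>m (Suc k) - positive_solution g1 g2 \<beta> (Suc N) (Suc k)\<bar> < \<epsilon>)"
proof -
  obtain a m M L D c :: real where pos: "0 < a" "0 < m" "0 < M" "0 < L" "0 < D" and
    data: "\<forall>h N. 0 < h \<longrightarrow> h * real N = 1 \<longrightarrow> (\<exists>b. a < b \<and> b \<le> c \<and> P h N b = 0 \<and>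
       (\<forall>x>0. P h N x = 0 \<longrightarrow> x = b) \<and>
       (\<forall>x. a \<le> x \<longrightarrow> x \<le> b \<longrightarrow> m * (b - x) \<le> P h N x \<and> P h N x \<le> M * (b - x) \<and>
          \<bar>P h N x + P' h N x * (b - x)\<bar> \<le> L * (b - x)\<^sup>2 \<and>
          (\<forall>k\<le>N. \<bar>G1.U h x k - G1.U h b k\<bar> \<le> D * (b - x))))"
    by (rule uniform_root_data)
  \<comment> \<open>The second argument turns a bound on the scaled error into one on the whole trajectory.\<close>
  define C where "C = max (2 * L / m + 3 * L * M\<^sup>2 / m ^ 3) (D + 1)"
  have C: "2 * L / m + 3 * L * M\<^sup>2 / m ^ 3 \<le> C" "D < C" "0 < C" using pos by (auto simp: C_def)
  define q where "q = max (1 - m / (2 * M)) 0"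
  have q: "0 \<le> q" "q < 1" "1 - m / (2 * M) \<le> q" using pos by (auto simp: q_def)
  have "(\<lambda>j. C * (q ^ j * (c - a))) \<longlonglongrightarrow> C * (0 * (c - a))"
    using q by (intro tendsto_intros) auto
  then have "\<forall>\<^sub>F j in sequentially. C * (q ^ j * (c - a)) < 1/2"
    by (rule order_tendstoD) simp
  then obtain J where J: "C * (q ^ J * (c - a)) < 1/2" by (meson eventually_sequentially order_refl)
  let ?p = "shooting_prog \<beta> a J (1 / (2 * M)) (3 * L / m ^ 3)"
  show ?thesis
  proof (intro exI[of _ ?p] exI[of _ J] allI impI)
    fix N :: nat and \<epsilon> :: real assume N: "N \<ge> 1" and \<epsilon>: "0 < \<epsilon>"
    obtain b where b: "a < b" "b \<le> c" "P (1 / real N) N b = 0"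
      and uniq: "\<And>x. 0 < x \<Longrightarrow> P (1 / real N) N x = 0 \<Longrightarrow> x = b"
      and est: "\<And>x. a \<le> x \<Longrightarrow> x \<le> b \<Longrightarrow> m * (b - x) \<le> P (1 / real N) N x \<and> P (1 / real N) N x \<le> M * (b - x) \<and>
          \<bar>P (1 / real N) N x + P' (1 / real N) N x * (b - x)\<bar> \<le> L * (b - x)\<^sup>2"
      and U: "\<And>x k. a \<le> x \<Longrightarrow> x \<le> b \<Longrightarrow> k \<le> N \<Longrightarrow>
          \<bar>G1.U (1 / real N) x k - G1.U (1 / real N) b k\<bar> \<le> D * (b - x)"
      using data[THEN spec[of _ "1 / real N"], THEN spec[of _ N]] N by fastforce
    have est': "\<And>x. a \<le> x \<Longrightarrow> x \<le> b \<Longrightarrow> m * (b - x) \<le> P (1 / real N) N x \<and> P (1 / real N) N x \<le> M * (b - x)"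
      using est by blast
    obtain s1 where s1: "exec g1 g2 (init_prog a) (input_state (Suc N) \<epsilon>) (N + 2) s1"
        "env N \<epsilon> a (1/2) 0 s1"
      using exec_init_prog[OF N] by blast
    obtain s2 x0 where s2: "exec g1 g2 (While (ILess (IReg 2) (INum J))
        (block [march_prog, residual_prog \<beta>, slow_step (1 / (2 * M))])) s1 (J * (9 * N + 22)) s2"
      "env N \<epsilon> x0 (1/2) J s2" "a \<le> x0" "x0 < b" "b - x0 \<le> (1 - m / (2 * M)) ^ J * (b - a)"
      using exec_slow_phase[OF N pos(3,2) b(1) est' s1(2)] by blast
    have "m * (b - a) \<le> M * (b - a)" using est[of a] b by linarith
    then have "m \<le> M" using b by simp
    then have "(1 - m / (2 * M)) ^ J \<le> q ^ J" using pos q by (intro power_mono) (auto simp: field_simps)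
    then have "(1 - m / (2 * M)) ^ J * (b - a) \<le> q ^ J * (c - a)"
      using b q by (intro mult_mono) auto
    then have "C * (b - x0) \<le> C * (q ^ J * (c - a))"
      using s2(5) C by (intro mult_left_mono) auto
    then have x0: "C * (b - x0) \<le> 1/2" using J by linarith
    obtain s3 x \<delta> where s3: "exec g1 g2 (While (RLess (INum 0) (reg 9))
        (block [march_prog, residual_prog \<beta>, newton_step (3 * L / m ^ 3)])) s2
          (rounds \<epsilon> * (9 * N + 27) + 1) s3"
      "env N \<epsilon> x \<delta> J s3" "a \<le> x" "x < b" "C * (b - x) \<le> \<epsilon>"
      using exec_newton_phase[OF N pos(2,4) C(1) est s2(2-4) x0 \<epsilon>] by blast
    obtain s4 where s4: "exec g1 g2 march_prog s3 (4 + 9 * N) s4" "marched N x N s4"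
      using exec_march_prog[OF N s3(2)] by blast
    obtain r mem where [simp]: "s4 = (r, mem)" by (cases s4)
    have "exec g1 g2 ?p (input_state (Suc N) \<epsilon>)
       (N + 2 + (J * (9 * N + 22) + (rounds \<epsilon> * (9 * N + 27) + 1 + (4 + 9 * N)))) (r, mem)"
      using exec.Seq[OF s1(1) exec.Seq[OF s2(1) exec.Seq[OF s3(1) s4(1)]]]
      unfolding shooting_prog_def block.simps by simp
    moreover have "\<bar>mem (Suc k) - positive_solution g1 g2 \<beta> (Suc N) (Suc k)\<bar> < \<epsilon>" if k: "k \<le> N" for k
    proof -
      have "positive_solution g1 g2 \<beta> (Suc N) (Suc k) = G1.U (1 / real N) b k"
        by (rule positive_solution_eq[OF N _ b(3) uniq k]) (use pos b in auto)
      moreover have "mem (Suc k) = G1.U (1 / real N) x k" using s4(2) k by (simp add: marched_def)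
      moreover have "D * (b - x) < C * (b - x)" using C s3 by (intro mult_strict_right_mono) auto
      ultimately show ?thesis using U[OF s3(3) _ k] s3(4,5) by linarith
    qed
    ultimately show "\<exists>r m. exec g1 g2 ?p (input_state (Suc N) \<epsilon>)
       (N + 2 + (J * (9 * N + 22) + (rounds \<epsilon> * (9 * N + 27) + 1 + (4 + 9 * N)))) (r, m) \<and>
       (\<forall>k\<le>N. \<bar>m (Suc k) - positive_solution g1 g2 \<beta> (Suc N) (Suc k)\<bar> < \<epsilon>)" by blast
  qed
qed

end

section \<open>The cost bound\<close>

lemma rate_of_class_C:
  assumes "class_C 3 g" "g 0 = 0"
    and "\<And>x. x > 0 \<Longrightarrow> deriv g x > 0 \<and> (deriv ^^ 2) g x > 0"
  shows "rate g (deriv g) (deriv (deriv g))"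
proof -
  have D: "(deriv ^^ j) g differentiable (at x)" if "j < 3" for j x
    using assms(1) that by (auto simp: class_C_def)
  note D0 = D[of 0] and D1 = D[of 1] and D2 = D[of 2]
  show ?thesis
  proof
    show "(g has_real_derivative deriv g x) (at x)" for x
      using D0 by (simp add: DERIV_deriv_iff_real_differentiable)
    show "(deriv g has_real_derivative deriv (deriv g) x) (at x)" for x
      using D1 by (simp add: DERIV_deriv_iff_real_differentiable)
    show "continuous_on UNIV (deriv (deriv g))"
      using D2 by (intro continuous_at_imp_continuous_on)
        (simp add: numeral_2_eq_2 differentiable_imp_continuous_within)
  qed (use assms in \<open>auto simp: numeral_2_eq_2\<close>)
qed

theorem theorem19:
  fixes g1 g2 g :: "real \<Rightarrow> real" and \<beta> :: real
  assumes "class_C 3 g1" and "class_C 3 g2"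
    and "real_analytic_at g1 0" and "real_analytic_at g2 0"
    and "g1 0 = 0" and "g2 0 = 0"
    and "\<And>x. x > 0 \<Longrightarrow> deriv g1 x > 0 \<and> (deriv ^^ 2) g1 x > 0 \<and> (deriv ^^ 3) g1 x \<ge> 0"
    and "\<And>x. x > 0 \<Longrightarrow> deriv g2 x > 0 \<and> (deriv ^^ 2) g2 x > 0 \<and> (deriv ^^ 3) g2 x \<ge> 0"
    and "\<beta> > 0"
    and g_def: "g = (\<lambda>x. g1 x / g2 x)"
    and "g ` {0<..} = {0<..}"
    and "\<And>x. x > 0 \<Longrightarrow> deriv g x < 0 \<and> (deriv ^^ 2) g x \<ge> 0"
  shows "\<exists>p T.
      (\<forall>n \<epsilon>. n \<ge> 2 \<longrightarrow> \<epsilon> > 0 \<longrightarrow>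
         (\<exists>v. computes g1 g2 p n \<epsilon> (T n \<epsilon>) v \<and>
              eps_approximation n \<epsilon> (positive_solution g1 g2 \<beta> n) v)) \<and>
      (\<forall>\<delta>>0. \<exists>C. \<forall>n \<epsilon>. n \<ge> 2 \<longrightarrow> 0 < \<epsilon> \<longrightarrow> \<epsilon> < 1 \<longrightarrow> log 2 (log 2 (1 / \<epsilon>)) \<ge> \<delta> \<longrightarrow>
         real (T n \<epsilon>) \<le> C * (real n * log 2 (log 2 (1 / \<epsilon>))))"
proof -
  interpret G1: rate g1 "deriv g1" "deriv (deriv g1)"
    using assms(1,5,7) by (intro rate_of_class_C) auto
  interpret G2: rate g2 "deriv g2" "deriv (deriv g2)"
    using assms(2,6,8) by (intro rate_of_class_C) auto
  interpret shooting g1 g2 \<beta>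
  proof
    show "0 < \<beta>" by fact
    show "(\<lambda>x. g1 x / g2 x) ` {0<..} = {0<..}" using assms(11) unfolding g_def .
    fix x :: real assume x: "0 < x"
    have "(g has_real_derivative (deriv g1 x * g2 x - g1 x * deriv g2 x) / (g2 x * g2 x)) (at x)"
      unfolding g_def using G2.g_pos[OF x] by (intro DERIV_divide G1.deriv_g G2.deriv_g) simp
    then have "(deriv g1 x * g2 x - g1 x * deriv g2 x) / (g2 x * g2 x) < 0"
      using assms(12)[OF x] DERIV_imp_deriv by metis
    then show "deriv g1 x * g2 x - g1 x * deriv g2 x < 0"
      using G2.g_pos[OF x] by (simp add: divide_less_0_iff zero_less_mult_iff)
  qed
  obtain p J where pJ: "\<And>N \<epsilon>. N \<ge> 1 \<Longrightarrow> 0 < \<epsilon> \<Longrightarrow> \<exists>r m.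
     exec g1 g2 p (input_state (Suc N) \<epsilon>)
       (N + 2 + (J * (9 * N + 22) + (rounds \<epsilon> * (9 * N + 27) + 1 + (4 + 9 * N)))) (r, m) \<and>
     (\<forall>k\<le>N. \<bar>m (Suc k) - positive_solution g1 g2 \<beta> (Suc N) (Suc k)\<bar> < \<epsilon>)"
    using shooting_prog_correct by blast
  define T where "T n \<epsilon> = (let N = n - 1 in
    N + 2 + (J * (9 * N + 22) + (rounds \<epsilon> * (9 * N + 27) + 1 + (4 + 9 * N))))" for n \<epsilon>
  have correct: "\<exists>v. computes g1 g2 p n \<epsilon> (T n \<epsilon>) v \<and> eps_approximation n \<epsilon> (positive_solution g1 g2 \<beta> n) v"
    if n: "n \<ge> 2" and \<epsilon>: "\<epsilon> > 0" for n \<epsilon>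
  proof -
    obtain N where N: "n = Suc N" "N \<ge> 1" using n by (cases n) auto
    from pJ[OF N(2) \<epsilon>] obtain r m where rm: "exec g1 g2 p (input_state n \<epsilon>) (T n \<epsilon>) (r, m)"
      "\<And>k. k \<le> N \<Longrightarrow> \<bar>m (Suc k) - positive_solution g1 g2 \<beta> n (Suc k)\<bar> < \<epsilon>"
      unfolding T_def N(1) Let_def by auto
    have "\<bar>m k - positive_solution g1 g2 \<beta> n k\<bar> < \<epsilon>" if "k \<in> {1..n}" for k
      using rm(2)[of "k - 1"] that N by (cases k) auto
    then have "eps_approximation n \<epsilon> (positive_solution g1 g2 \<beta> n) m"
      unfolding eps_approximation_def linf_norm_def using n by (subst Max_less_iff) auto
    moreover have "computes g1 g2 p n \<epsilon> (T n \<epsilon>) m" unfolding computes_def using rm(1) by blast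
    ultimately show ?thesis by blast
  qed
  have T_le: "T n \<epsilon> \<le> (40 + 31 * J + 36 * rounds \<epsilon>) * n" if n: "n \<ge> 2" for n \<epsilon>
  proof -
    obtain N where N: "n = Suc N" "N \<ge> 1" using n by (cases n) auto
    have "J * (9 * N + 22) \<le> J * (31 * Suc N)" by (intro mult_left_mono) auto
    moreover have "rounds \<epsilon> * (9 * N + 27) \<le> rounds \<epsilon> * (36 * Suc N)" by (intro mult_left_mono) auto
    ultimately show ?thesis unfolding T_def Let_def N(1) by (simp add: algebra_simps)
  qed
  have cost: "\<exists>C. \<forall>n \<epsilon>. n \<ge> 2 \<longrightarrow> 0 < \<epsilon> \<longrightarrow> \<epsilon> < 1 \<longrightarrow> log 2 (log 2 (1 / \<epsilon>)) \<ge> \<delta> \<longrightarrow>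
         real (T n \<epsilon>) \<le> C * (real n * log 2 (log 2 (1 / \<epsilon>)))" if \<delta>: "\<delta> > 0" for \<delta> :: real
  proof (intro exI allI impI)
    fix n :: nat and \<epsilon> :: real assume n: "n \<ge> 2" and \<epsilon>: "0 < \<epsilon>" "\<epsilon> < 1" and l: "\<delta> \<le> log 2 (log 2 (1 / \<epsilon>))"
    define l where "l = log 2 (log 2 (1 / \<epsilon>))"
    define A where "A = 76 + 31 * real J"
    have "\<delta> \<le> l" using l by (simp add: l_def)
    \<comment> \<open>The part of the cost that does not depend on \<open>\<epsilon>\<close> is absorbed using \<open>l \<ge> \<delta>\<close>.\<close>
    have A: "0 \<le> A" by (simp add: A_def)
    have "real (rounds \<epsilon>) \<le> l + 1" unfolding l_def using rounds_bound[OF \<epsilon>] l \<delta> by simp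
    then have "40 + 31 * real J + 36 * real (rounds \<epsilon>) \<le> A + 36 * l" by (simp add: A_def)
    also have "A \<le> A / \<delta> * l"
      using mult_left_mono[OF \<open>\<delta> \<le> l\<close> A] \<delta> by (simp add: field_simps)
    finally have *: "40 + 31 * real J + 36 * real (rounds \<epsilon>) \<le> (A / \<delta> + 36) * l"
      by (simp add: algebra_simps)
    have "real (T n \<epsilon>) \<le> (40 + 31 * real J + 36 * real (rounds \<epsilon>)) * real n"
      using of_nat_mono[OF T_le[OF n, of \<epsilon>], where 'a = real] by simp
    also have "\<dots> \<le> ((A / \<delta> + 36) * l) * real n" using * by (intro mult_right_mono) auto
    finally show "real (T n \<epsilon>) \<le> ((76 + 31 * real J) / \<delta> + 36) * (real n * log 2 (log 2 (1 / \<epsilon>)))"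
      by (simp add: A_def l_def mult_ac)
  qed
  show ?thesis
    using correct cost by (intro exI[of _ p] exI[of _ T]) blast
qed

end
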